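(* Let $X\sim\operatorname{Bin}(N,p)$, $0<p<1$, $q=1-p$, and $h_N=\lceil Np\rceil-Np\in[0,1)$ (so $h_N=0$ when $Np\in\mathbb Z$). Then, as $N\to\infty$, $$\mathbb E|X-Np|\sim\sqrt{\frac{2Npq}{\pi}}\;\exp\Bigl(\sum_{k\ge1}\frac{a_k(h_N;p)}{N^k}\Bigr),$$ where, for $k\ge1$, $$a_k(h;p)=\frac{(-1)^{k+1}}{k(k+1)}\Bigl[B_{k+1}-\bigl(p^{-k}+(-1)^{k+1}q^{-k}\bigr)B_{k+1}(h)\Bigr].$$ Separating parities, for $j\ge1$, $$a_{2j-1}(h;p)=\frac{1}{2j(2j-1)}\Bigl[B_{2j}-\bigl(p^{1-2j}+q^{1-2j}\bigr)B_{2j}(h)\Bigr],\qquad a_{2j}(h;p)=\frac{p^{-2j}-q^{-2j}}{2j(2j+1)}\,B_{2j+1}(h).$$ Equivalently, $$\mathbb E|X-Np|\sim\sqrt{\frac{2Npq}{\pi}}\sum_{m\ge0}\frac{d_m(h_N;p)}{N^m},\qquad d_0=1,\quad d_m(h;p)=\frac1m\sum_{k=1}^{m}k\,a_k(h;p)\,d_{m-k}(h;p)\quad(m\ge1).$$ More precisely, for every $M\ge0$ and every compact $K\subset(0,1)$, $$\mathbb E|X-Np|=\sqrt{\frac{2Npq}{\pi}}\,\Bigl(\sum_{m=0}^{M}\frac{d_m(h_N;p)}{N^{m}}+O(N^{-M-1})\Bigr),$$ with an implied constant depending only on $M$ and $K$, uniformly for $p\in K$. (The remainder is relative to the leading factor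 $\sqrt{2Npq/\pi}$; in absolute terms it is $O(N^{-M-\frac12})$.) In particular the expansion contains only integer powers of $N^{-1}$ relative to the leading term.
   Context: $B_k(t)$ are the Bernoulli polynomials, $\frac{z e^{tz}}{e^z-1}=\sum_{k\ge0}B_k(t)\frac{z^k}{k!}$, and $B_k=B_k(0)$ the Bernoulli numbers (so $B_1=-\tfrac12$). $\operatorname{Bin}(N,p)$ is the binomial distribution. Convention on asymptotic expansions: $f(x)\sim g(x)\sum_{n\ge0}c_nx^{-n}$ means that for every fixed $M$, $f(x)=g(x)\bigl(\sum_{n=0}^{M}c_nx^{-n}+O(x^{-M-1})\bigr)$, with implied constant uniform in all parameters ranging over the specified compact sets. When an expansion is displayed as the exponential of a series, the logarithmic series is truncated at a fixed order and the exponential is re-expanded to the same order. The coefficients here depend on $N$ through $h_N$. *)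

theory Defs
  imports "HOL-Probability.Probability" "HOL-Computational_Algebra.Formal_Power_Series"
begin

(* B_k(t) is k! times the k-th coefficient of z e^(tz) / (e^z - 1).  The division of formal power
   series cancels the common factor z. *)
definition bernoulli_poly :: "nat \<Rightarrow> real \<Rightarrow> real" where
  "bernoulli_poly k t = fact k * fps_nth ((fps_X * fps_exp t) / (fps_exp 1 - 1)) k"

definition bernoulli_number :: "nat \<Rightarrow> real" where
  "bernoulli_number k = bernoulli_poly k 0"

definition mean_abs_dev :: "nat \<Rightarrow> real \<Rightarrow> real" where
  "mean_abs_dev N p =
     measure_pmf.expectation (binomial_pmf N p) (\<lambda>X. \<bar>real X - real N * p\<bar>)"

definition lead :: "nat \<Rightarrow> real \<Rightarrow> real" where
  "lead N p = sqrt (2 * real N * p * (1 - p) / pi)"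

definition hN :: "nat \<Rightarrow> real \<Rightarrow> real" where
  "hN N p = real_of_int \<lceil>real N * p\<rceil> - real N * p"

(* Only the values for k >= 1 are meaningful. *)
definition a_coeff :: "nat \<Rightarrow> real \<Rightarrow> real \<Rightarrow> real" where
  "a_coeff k h p =
     (-1) ^ (k + 1) / (real k * real (k + 1)) *
     (bernoulli_number (k + 1)
      - (p powi (- int k) + (-1) ^ (k + 1) * (1 - p) powi (- int k)) * bernoulli_poly (k + 1) h)"

fun d_coeff :: "nat \<Rightarrow> real \<Rightarrow> real \<Rightarrow> real" where
  "d_coeff m h p =
     (if m = 0 then 1
      else (1 / real m) * (\<Sum>k = 1..m. real k * a_coeff k h p * d_coeff (m - k) h p))"

declare d_coeff.simps [simp del]

(* f(N,p) ~ g(N,p) * (SUM n. c n N p / N^n) as N -> infinity, uniformly for p in compact subsets of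
   (0,1).  The coefficients may depend on N.  The implied constant C depends only on the truncation
   order M and on K; the bound is required for all N >= 1. *)
definition asymp_expansion ::
    "(nat \<Rightarrow> real \<Rightarrow> real) \<Rightarrow> (nat \<Rightarrow> real \<Rightarrow> real) \<Rightarrow> (nat \<Rightarrow> nat \<Rightarrow> real \<Rightarrow> real) \<Rightarrow> bool" where
  "asymp_expansion f g c \<longleftrightarrow>
     (\<forall>M K. compact K \<and> K \<subseteq> {0<..<1} \<longrightarrow>
        (\<exists>C. \<forall>N\<ge>1. \<forall>p\<in>K. \<exists>r. \<bar>r\<bar> \<le> C / real N ^ (M + 1) \<and>
           f N p = g N p * ((\<Sum>n\<le>M. c n N p / real N ^ n) + r)))"

(* The coefficient of z^n in exp (a 1 z + ... + a M z^M). *)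
definition exp_coeff :: "nat \<Rightarrow> (nat \<Rightarrow> real) \<Rightarrow> nat \<Rightarrow> real" where
  "exp_coeff M a n =
     fps_nth (fps_exp 1 oo Abs_fps (\<lambda>k. if 1 \<le> k \<and> k \<le> M then a k else 0)) n"

(* f(N,p) ~ g(N,p) * exp (SUM k>=1. a k N p / N^k): for each M the logarithmic series is truncated
   at order M and its exponential is re-expanded to order M. *)
definition exp_asymp_expansion ::
    "(nat \<Rightarrow> real \<Rightarrow> real) \<Rightarrow> (nat \<Rightarrow> real \<Rightarrow> real) \<Rightarrow> (nat \<Rightarrow> nat \<Rightarrow> real \<Rightarrow> real) \<Rightarrow> bool" where
  "exp_asymp_expansion f g a \<longleftrightarrow>
     (\<forall>M K. compact K \<and> K \<subseteq> {0<..<1} \<longrightarrow>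
        (\<exists>C. \<forall>N\<ge>1. \<forall>p\<in>K. \<exists>r. \<bar>r\<bar> \<le> C / real N ^ (M + 1) \<and>
           f N p = g N p * ((\<Sum>n\<le>M. exp_coeff M (\<lambda>k. a k N p) n / real N ^ n) + r)))"

end

theory Submission
  imports Defs "HOL-Real_Asymp.Real_Asymp"
begin

text \<open>
  Writing \<open>b k\<close> for the binomial probabilities, \<open>(k - N p) b k\<close> is a difference of consecutive terms
  of \<open>T k = k q b k\<close>. Summing it with the right signs gives de Moivre's formula
  \<open>E|X - N p| = 2 T \<nu>\<close> with \<open>\<nu> = \<lceil>N p\<rceil>\<close>, a quotient of factorials. It remains to expand
  \<open>ln n!\<close> with \<open>n + 1 = x + h\<close> in powers of \<open>1 / x\<close>, uniformly in \<open>h \<in> [0, 1]\<close>: formally the sum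
  \<open>S(x, h) = \<Sum>\<^sub>j B\<^sub>j(h)/j! G\<^sup>(\<^sup>j\<^sup>)(x)\<close> with \<open>G x = x ln x - x\<close> satisfies \<open>S(x + 1, h) - S(x, h) = ln (x + h)\<close>,
  because \<open>(e\<^sup>D - 1) (D e\<^sup>h\<^sup>D / (e\<^sup>D - 1)) G = e\<^sup>h\<^sup>D G'\<close>. Truncating \<open>S\<close> gives a small error by Taylor's
  theorem; summing the errors over \<open>x, x + 1, x + 2, \<dots>\<close> gives Stirling's expansion up to a constant,
  which Wallis' product determines.
\<close>

unbundle no vec_syntax
unbundle fps_syntax

subsection \<open>Bernoulli polynomials\<close>

definition bernoulli_fps :: "real \<Rightarrow> real fps" where
  "bernoulli_fps t = fps_X * fps_exp t / (fps_exp 1 - 1)"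

lemma bernoulli_poly_eq: "bernoulli_poly k t = fact k * bernoulli_fps t $ k"
  by (simp add: bernoulli_poly_def bernoulli_fps_def)

text \<open>Dividing and multiplying back is exact only under divisibility. The divisor has
  subdegree 1, which the factor \<open>fps_X\<close> matches.\<close>

lemma fps_exp_minus_1_dvd: "fps_exp 1 - 1 dvd (fps_X * f :: real fps)"
proof -
  have "subdegree (fps_exp 1 - 1 :: real fps) = 1"
    by (rule subdegreeI) auto
  then show ?thesis
    by (cases "f = 0") (auto simp: fps_dvd_iff)
qed

lemma fps_exp_minus_1_nz: "fps_exp 1 - 1 \<noteq> (0 :: real fps)"
proof
  assume "fps_exp 1 - 1 = (0 :: real fps)"
  then have "(fps_exp 1 - 1 :: real fps) $ 1 = 0" by simp
  then show False by simp
qed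

lemma bernoulli_fps_mult: "bernoulli_fps t * (fps_exp 1 - 1) = fps_X * fps_exp t"
  unfolding bernoulli_fps_def by (rule dvd_div_mult_self[OF fps_exp_minus_1_dvd])

text \<open>Cancelling the nonzero factor \<open>fps_exp 1 - 1\<close> makes the product identity a
  characterisation; the shift, reflection and value at 1 all follow by checking it.\<close>

lemma bernoulli_fps_eqI: "f * (fps_exp 1 - 1) = fps_X * fps_exp t \<Longrightarrow> bernoulli_fps t = f"
  using bernoulli_fps_mult[of t] fps_exp_minus_1_nz by (metis mult_right_cancel)

lemma bernoulli_fps_shift: "bernoulli_fps t = bernoulli_fps 0 * fps_exp t"
proof (rule bernoulli_fps_eqI)
  have "bernoulli_fps 0 * fps_exp t * (fps_exp 1 - 1) =
      (bernoulli_fps 0 * (fps_exp 1 - 1)) * fps_exp t"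
    by (simp add: mult_ac)
  then show "bernoulli_fps 0 * fps_exp t * (fps_exp 1 - 1) = fps_X * fps_exp t"
    by (simp add: bernoulli_fps_mult)
qed

text \<open>Replacing z by -z in the product identity gives F(-z) (e^(-z) - 1) = -z e^(-tz).
  Multiplying by e^z turns this into the identity that characterises the series at 1 - t.\<close>

lemma bernoulli_fps_reflect: "bernoulli_fps (1 - t) $ k = (-1) ^ k * bernoulli_fps t $ k"
proof -
  let ?m = "fps_const (-1) * fps_X :: real fps"
  have "(bernoulli_fps t oo ?m) * (fps_exp (-1) - 1) = ?m * fps_exp (- t)"
  proof -
    have "(bernoulli_fps t * (fps_exp 1 - 1)) oo ?m = (fps_X * fps_exp t) oo ?m"
      by (simp only: bernoulli_fps_mult)
    then show ?thesis
      by (simp add: fps_compose_mult_distrib fps_compose_sub_distrib fps_exp_compose_linear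
          del: fps_const_neg)
  qed
  then have "(bernoulli_fps t oo ?m) * (fps_exp (-1) - 1) * fps_exp 1
      = ?m * fps_exp (- t) * fps_exp 1" by simp
  then have "(bernoulli_fps t oo ?m) * ((fps_exp (-1) * fps_exp 1) - fps_exp 1)
      = ?m * (fps_exp (- t) * fps_exp 1)" by (simp add: algebra_simps)
  then have "(bernoulli_fps t oo ?m) * (1 - fps_exp 1) = ?m * fps_exp (1 - t)"
    by (simp flip: fps_exp_add_mult)
  then have "(bernoulli_fps t oo ?m) * (fps_exp 1 - 1) = fps_X * fps_exp (1 - t)"
    by (simp add: algebra_simps flip: fps_const_neg)
  then have "bernoulli_fps (1 - t) = bernoulli_fps t oo ?m"
    by (rule bernoulli_fps_eqI)
  then show ?thesis
    by (simp add: fps_nth_compose_linear)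
qed

lemma bernoulli_fps_1: "bernoulli_fps 1 = bernoulli_fps 0 + fps_X"
  by (rule bernoulli_fps_eqI) (simp add: bernoulli_fps_mult distrib_right, simp add: algebra_simps)

text \<open>At odd indices reflection makes the values at 0 and 1 opposite, while by
  \<open>bernoulli_fps_1\<close> they agree beyond index 1.\<close>

lemma bernoulli_fps_odd: "bernoulli_fps 0 $ (2 * j + 1) = 0" if "j \<ge> 1"
proof -
  have "bernoulli_fps 1 $ (2 * j + 1) = bernoulli_fps 0 $ (2 * j + 1)"
    using that by (simp add: bernoulli_fps_1)
  then show ?thesis
    using bernoulli_fps_reflect[of 0 "2 * j + 1"] by simp
qed

lemma bernoulli_fps_0 [simp]: "bernoulli_fps t $ 0 = 1"
  and bernoulli_fps_Suc_0 [simp]: "bernoulli_fps t $ Suc 0 = t - 1 / 2"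
proof -
  have "(bernoulli_fps t * (fps_exp 1 - 1)) $ 1 = (fps_X * fps_exp t) $ 1"
    by (simp only: bernoulli_fps_mult)
  then show 0: "bernoulli_fps t $ 0 = 1"
    by (simp add: fps_mult_nth)
  have "(bernoulli_fps t * (fps_exp 1 - 1)) $ 2 = (fps_X * fps_exp t) $ 2"
    by (simp only: bernoulli_fps_mult)
  then show "bernoulli_fps t $ Suc 0 = t - 1 / 2"
    using 0 by (simp add: fps_mult_nth eval_nat_numeral)
qed

text \<open>The shift \<open>hN N p\<close> wanders irregularly through [0, 1) as N grows, so every
  estimate has to be uniform in t.\<close>

lemma bernoulli_fps_bounded:
  obtains B where "B \<ge> 0" "\<And>t. 0 \<le> t \<Longrightarrow> t \<le> 1 \<Longrightarrow> \<bar>bernoulli_fps t $ k\<bar> \<le> B"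
proof
  let ?B = "\<Sum>i=0..k. \<bar>bernoulli_fps 0 $ i\<bar>"
  show "?B \<ge> 0" by (simp add: sum_nonneg)
  fix t :: real
  assume t: "0 \<le> t" "t \<le> 1"
  have "\<bar>bernoulli_fps t $ k\<bar> \<le> (\<Sum>i=0..k. \<bar>bernoulli_fps 0 $ i * (t ^ (k - i) / fact (k - i))\<bar>)"
    by (subst bernoulli_fps_shift) (simp only: fps_mult_nth fps_exp_nth of_nat_fact sum_abs)
  also have "\<dots> \<le> ?B"
  proof (rule sum_mono)
    fix i
    have "t ^ (k - i) \<le> 1" "(1 :: real) \<le> fact (k - i)"
      using t by (auto simp: power_le_one fact_ge_1)
    then have "t ^ (k - i) / fact (k - i) \<le> 1" by (metis divide_le_eq_1_pos fact_gt_zero order_trans)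
    moreover have "t ^ (k - i) / fact (k - i) \<ge> 0" using t by simp
    ultimately show "\<bar>bernoulli_fps 0 $ i * (t ^ (k - i) / fact (k - i))\<bar> \<le> \<bar>bernoulli_fps 0 $ i\<bar>"
      by (simp only: abs_mult abs_of_nonneg mult_left_le abs_ge_zero)
  qed
  finally show "\<bar>bernoulli_fps t $ k\<bar> \<le> ?B" .
qed

section \<open>Derivatives of x ln x - x\<close>

fun xlnx_deriv :: "nat \<Rightarrow> real \<Rightarrow> real" where
  "xlnx_deriv 0 x = x * ln x - x"
| "xlnx_deriv (Suc 0) x = ln x"
| "xlnx_deriv (Suc (Suc k)) x = (-1) ^ k * fact k / x ^ Suc k"

lemma DERIV_xlnx_deriv:
  assumes "x > 0"
  shows "(xlnx_deriv j has_real_derivative xlnx_deriv (Suc j) x) (at x)"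
proof -
  consider "j = 0" | "j = 1" | k where "j = Suc (Suc k)"
    by (metis One_nat_def not0_implies_Suc)
  then show ?thesis
  proof cases
    case 1
    have "xlnx_deriv 0 = (\<lambda>x. x * ln x - x)" by (simp add: fun_eq_iff)
    with 1 assms show ?thesis by (auto intro!: derivative_eq_intros)
  next
    case 2
    have "xlnx_deriv 1 = ln" by (simp add: fun_eq_iff)
    with 2 assms show ?thesis by (auto intro!: derivative_eq_intros simp: divide_simps)
  next
    case 3
    have "xlnx_deriv j = (\<lambda>x. (-1) ^ k * fact k / x ^ Suc k)" by (simp add: 3 fun_eq_iff)
    with 3 assms show ?thesis
      by (auto intro!: derivative_eq_intros simp: divide_simps) (cases k; simp add: algebra_simps)
  qed
qed

subsection \<open>Stirling's expansion at a shifted argument\<close>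

text \<open>The condition \<open>j + n = m + 2\<close> makes the Lagrange remainder involve the
  derivative of index m + 2, of absolute value m! / t^(m+1). This decreases in t, so it is estimated
  at t = x; the factor 1/n! is bounded by 1.\<close>

lemma xlnx_deriv_taylor:
  assumes "x > 0" "0 \<le> h" "j + n = m + 2" "n > 0"
  shows "\<bar>xlnx_deriv j (x + h) - (\<Sum>i<n. xlnx_deriv (j + i) x * (h ^ i / fact i))\<bar>
    \<le> fact m * h ^ n / x ^ Suc m"
\<comment> \<open>\<open>Taylor_up\<close> needs a proper interval, so h = 0 is treated
  separately.\<close>
proof (cases "h = 0")
  case True
  have "(\<Sum>i<n. xlnx_deriv (j + i) x * (0 ^ i / fact i)) = xlnx_deriv j x"
    using \<open>n > 0\<close> by (subst sum.remove[of _ 0]) (auto intro!: sum.neutral)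
  with True \<open>n > 0\<close> \<open>x > 0\<close> show ?thesis by simp
next
  case False
  let ?d = "\<lambda>i. xlnx_deriv (j + i)"
  have "\<exists>t>x. t < x + h \<and> xlnx_deriv j (x + h) =
      (\<Sum>i<n. ?d i x / fact i * (x + h - x) ^ i) + ?d n t / fact n * (x + h - x) ^ n"
    by (rule Taylor_up[where a = x and b = "x + h"])
      (use assms False in \<open>auto intro!: DERIV_xlnx_deriv\<close>)
  then obtain t where t: "t > x" "xlnx_deriv j (x + h) =
      (\<Sum>i<n. ?d i x / fact i * (x + h - x) ^ i) + ?d n t / fact n * (x + h - x) ^ n"
    by blast
  have "\<bar>?d n t / fact n * h ^ n\<bar> = fact m * h ^ n / (t ^ Suc m * fact n)"
    using t assms by (simp add: abs_mult)
  also have "\<dots> \<le> fact m * h ^ n / (x ^ Suc m * 1)"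
    by (intro divide_left_mono mult_mono power_mono)
      (use t assms in \<open>auto intro!: fact_ge_1 mult_pos_pos\<close>)
  finally show ?thesis using t(2) by (simp add: mult.commute)
qed

definition stirling_sum :: "nat \<Rightarrow> real \<Rightarrow> real \<Rightarrow> real" where
  "stirling_sum m x h = (\<Sum>j\<le>m. bernoulli_fps h $ j * xlnx_deriv j x)"

text \<open>With \<open>g n\<close> read as the n-th derivative of G, this is a truncation of (D
  e^(hD) / (e^D - 1)) (e^D - 1) = D e^(hD). Grouping by n = j + i gives complete coefficients of the
  product series, since exactly the pairs with j + i <= m + 1 occur.\<close>

lemma bernoulli_fps_sum_shift:
  fixes g :: "nat \<Rightarrow> real"
  shows "(\<Sum>j\<le>m. bernoulli_fps h $ j * (\<Sum>i\<in>{1..m + 1 - j}. g (j + i) / fact i)) =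
    (\<Sum>i\<le>m. g (Suc i) * h ^ i / fact i)"
proof -
  define e where "e = (fps_exp 1 - 1 :: real fps)"
  have e: "e $ 0 = 0" "i > 0 \<Longrightarrow> e $ i = 1 / fact i" for i
    by (auto simp: e_def)
  have "(\<Sum>j\<le>m. bernoulli_fps h $ j * (\<Sum>i\<in>{1..m + 1 - j}. g (j + i) / fact i)) =
      (\<Sum>j\<le>m. \<Sum>i\<le>m + 1 - j. bernoulli_fps h $ j * e $ i * g (j + i))"
    unfolding sum_distrib_left
    by (intro sum.cong refl sum.mono_neutral_cong_left) (auto simp: e not_le)
  \<comment> \<open>The new outer index j = m + 1 admits only i = 0, where \<open>e\<close>
    vanishes.\<close>
  also have "\<dots> = (\<Sum>j\<le>m + 1. \<Sum>i\<le>m + 1 - j. bernoulli_fps h $ j * e $ i * g (j + i))"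
    by (simp add: e)
  also have "\<dots> = (\<Sum>(j, i)\<in>{(j, i). j + i \<le> m + 1}. bernoulli_fps h $ j * e $ i * g (j + i))"
    by (subst sum.Sigma) (auto intro!: sum.cong)
  also have "\<dots> = (\<Sum>n\<le>m + 1. \<Sum>j\<le>n. bernoulli_fps h $ j * e $ (n - j) * g n)"
    by (subst sum.triangle_reindex_eq) simp
  also have "\<dots> = (\<Sum>n\<le>m + 1. (bernoulli_fps h * e) $ n * g n)"
    by (simp add: fps_mult_nth sum_distrib_right atLeast0AtMost)
  also have "\<dots> = (\<Sum>i\<le>m. g (Suc i) * h ^ i / fact i)"
    unfolding Suc_eq_plus1[symmetric] sum.atMost_Suc_shift
    by (simp add: e_def bernoulli_fps_mult mult.commute)
  finally show ?thesis .
qed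

text \<open>The j-th derivative at x + 1 is expanded to m + 2 - j terms and ln (x + h) to m + 1
  terms. All remainders then have order x^(-m-1), and the Taylor polynomials cancel by
  \<open>bernoulli_fps_sum_shift\<close>.\<close>

lemma stirling_sum_step:
  obtains C where "C \<ge> 0" "\<And>x h. x > 0 \<Longrightarrow> 0 \<le> h \<Longrightarrow> h \<le> 1 \<Longrightarrow>
    \<bar>ln (x + h) - (stirling_sum m (x + 1) h - stirling_sum m x h)\<bar> \<le> C / x ^ Suc m"
proof -
  have "\<exists>B. B \<ge> 0 \<and> (\<forall>t. 0 \<le> t \<and> t \<le> 1 \<longrightarrow> \<bar>bernoulli_fps t $ j\<bar> \<le> B)" for j
    using bernoulli_fps_bounded[of j] by metis
  then obtain B where B: "B j \<ge> 0" "0 \<le> t \<Longrightarrow> t \<le> 1 \<Longrightarrow> \<bar>bernoulli_fps t $ j\<bar> \<le> B j" for j t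
    by metis
  define C where "C = (1 + (\<Sum>j\<le>m. B j)) * fact m"
  show ?thesis
  proof (rule that[of C])
    show "C \<ge> 0" unfolding C_def by (intro mult_nonneg_nonneg add_nonneg_nonneg sum_nonneg) (auto simp: B)
    fix x h :: real
    assume x: "x > 0" and h: "0 \<le> h" "h \<le> 1"
    define r where "r = (\<lambda>j. xlnx_deriv j (x + 1) - (\<Sum>i<m + 2 - j. xlnx_deriv (j + i) x / fact i))"
    define s where "s = ln (x + h) - (\<Sum>i<Suc m. xlnx_deriv (1 + i) x * (h ^ i / fact i))"
    have r: "\<bar>r j\<bar> \<le> fact m / x ^ Suc m" if "j \<le> m" for j
      using xlnx_deriv_taylor[of x 1 j "m + 2 - j" m] x that by (simp add: r_def)
    have "\<bar>s\<bar> \<le> fact m * h ^ Suc m / x ^ Suc m"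
      using xlnx_deriv_taylor[of x h 1 "Suc m" m] x h by (simp add: s_def del: sum.lessThan_Suc)
    also have "\<dots> \<le> fact m * 1 / x ^ Suc m"
      using x h by (intro divide_right_mono mult_left_mono power_le_one) auto
    finally have s: "\<bar>s\<bar> \<le> fact m / x ^ Suc m" by simp
    have "stirling_sum m (x + 1) h - stirling_sum m x h =
        (\<Sum>j\<le>m. bernoulli_fps h $ j * (xlnx_deriv j (x + 1) - xlnx_deriv j x))"
      by (simp add: stirling_sum_def sum_subtractf algebra_simps)
    also have "\<dots> = (\<Sum>j\<le>m. bernoulli_fps h $ j * (r j + (\<Sum>i\<in>{1..m + 1 - j}. xlnx_deriv (j + i) x / fact i)))"
    proof (intro sum.cong refl)
      fix j assume "j \<in> {..m}"
      \<comment> \<open>The term i = 0 of the Taylor polynomial cancels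
        \<open>xlnx_deriv j x\<close>.\<close>
      then have "{..<m + 2 - j} = insert 0 {1..m + 1 - j}" by auto
      then show "bernoulli_fps h $ j * (xlnx_deriv j (x + 1) - xlnx_deriv j x) =
         bernoulli_fps h $ j * (r j + (\<Sum>i\<in>{1..m + 1 - j}. xlnx_deriv (j + i) x / fact i))"
        by (simp add: r_def)
    qed
    also have "\<dots> = (\<Sum>j\<le>m. bernoulli_fps h $ j * r j) +
       (\<Sum>j\<le>m. bernoulli_fps h $ j * (\<Sum>i\<in>{1..m + 1 - j}. xlnx_deriv (j + i) x / fact i))"
      by (simp only: distrib_left sum.distrib)
    also have "(\<Sum>j\<le>m. bernoulli_fps h $ j * (\<Sum>i\<in>{1..m + 1 - j}. xlnx_deriv (j + i) x / fact i))
       = ln (x + h) - s"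
      by (subst bernoulli_fps_sum_shift) (simp add: s_def lessThan_Suc_atMost)
    finally have "\<bar>ln (x + h) - (stirling_sum m (x + 1) h - stirling_sum m x h)\<bar> =
       \<bar>s - (\<Sum>j\<le>m. bernoulli_fps h $ j * r j)\<bar>" by simp
    also have "\<dots> \<le> \<bar>s\<bar> + (\<Sum>j\<le>m. \<bar>bernoulli_fps h $ j\<bar> * \<bar>r j\<bar>)"
      by (rule order_trans[OF abs_triangle_ineq4])
        (auto simp flip: abs_mult intro!: sum_abs)
    also have "\<dots> \<le> fact m / x ^ Suc m + (\<Sum>j\<le>m. B j * (fact m / x ^ Suc m))"
      by (intro add_mono sum_mono mult_mono s r B) (use h in \<open>auto simp: B\<close>)
    also have "\<dots> = C / x ^ Suc m"
      by (simp add: C_def algebra_simps add_divide_distrib sum_distrib_left sum_divide_distrib)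
    finally show "\<bar>ln (x + h) - (stirling_sum m (x + 1) h - stirling_sum m x h)\<bar> \<le> C / x ^ Suc m" .
  qed
qed

text \<open>This makes the local error telescope. The difference dominates 1 / (x+1)^(m+1), and
  going back from x + 1 to x costs a power of (x + 1) / x <= 1 + 1/\<delta>.\<close>

lemma inverse_power_diff_ge:
  fixes x \<delta> :: real
  assumes "\<delta> > 0" "x \<ge> \<delta>" "m \<ge> 1"
  shows "1 / x ^ Suc m \<le> (1 + 1 / \<delta>) ^ Suc m * (1 / x ^ m - 1 / (x + 1) ^ m)"
proof -
  have x: "x > 0" using assms by linarith
  have "(1 :: real) / (x + 1) ^ Suc m \<le> 1 / x ^ m - 1 / (x + 1) ^ m"
  proof -
    have "1 / (x + 1) ^ Suc m + 1 / (x + 1) ^ m \<le> 1 / x ^ m"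
    proof -
      obtain k where m: "m = Suc k" using assms by (cases m) auto
      have "1 / (x + 1) ^ Suc m + 1 / (x + 1) ^ m = (x + 2) / (x + 1)\<^sup>2 * (1 / (x + 1) ^ k)"
        using x by (simp add: m divide_simps power2_eq_square)
      also have "\<dots> \<le> 1 / x * (1 / x ^ k)"
      proof (intro mult_mono divide_left_mono power_mono)
        have "(x + 2) * x \<le> (x + 1)\<^sup>2" by (simp add: power2_eq_square algebra_simps)
        then show "(x + 2) / (x + 1)\<^sup>2 \<le> 1 / x"
          using x by (simp add: pos_divide_le_eq pos_le_divide_eq del: mult_eq_0_iff)
      qed (use x in auto)
      finally show ?thesis by (simp add: m)
    qed
    then show ?thesis by linarith
  qed
  then have "(1 + 1 / \<delta>) ^ Suc m * (1 / (x + 1) ^ Suc m) \<le>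
      (1 + 1 / \<delta>) ^ Suc m * (1 / x ^ m - 1 / (x + 1) ^ m)"
    using assms by (intro mult_left_mono) auto
  moreover have "1 / x ^ Suc m \<le> (1 + 1 / \<delta>) ^ Suc m * (1 / (x + 1) ^ Suc m)"
  proof -
    have "1 / x \<le> (1 + 1 / \<delta>) / (x + 1)"
      using assms x by (simp add: divide_simps) (simp add: algebra_simps)
    then have "(1 / x) ^ Suc m \<le> ((1 + 1 / \<delta>) / (x + 1)) ^ Suc m"
      using x by (intro power_mono) auto
    then show ?thesis by (simp add: power_divide)
  qed
  ultimately show ?thesis by linarith
qed

text \<open>Raising n and x by 1 keeps h fixed and adds ln (x + h) to the logarithm of the
  factorial. The local errors therefore telescope to a bound that stays finite as k grows.\<close>

lemma stirling_sum_ln_fact_diff: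
  assumes "\<delta> > 0" "m \<ge> 1"
  obtains C where "C \<ge> 0" "\<And>n x h k. 0 \<le> h \<Longrightarrow> h \<le> 1 \<Longrightarrow> x \<ge> \<delta> \<Longrightarrow> x + h = real (Suc n) \<Longrightarrow>
    \<bar>(ln (fact (n + k)) - stirling_sum m (x + real k) h) - (ln (fact n) - stirling_sum m x h)\<bar>
      \<le> C * (1 / x ^ m - 1 / (x + real k) ^ m)"
proof -
  obtain C0 where C0: "C0 \<ge> 0" "\<And>x h. x > 0 \<Longrightarrow> 0 \<le> h \<Longrightarrow> h \<le> 1 \<Longrightarrow>
    \<bar>ln (x + h) - (stirling_sum m (x + 1) h - stirling_sum m x h)\<bar> \<le> C0 / x ^ Suc m"
    using stirling_sum_step by blast
  define C where "C = C0 * (1 + 1 / \<delta>) ^ Suc m"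
  show ?thesis
  proof (rule that[of C])
    show "C \<ge> 0" using C0 assms by (simp add: C_def)
    fix n k :: nat and x h :: real
    assume h: "0 \<le> h" "h \<le> 1" and x: "x \<ge> \<delta>" and n: "x + h = real (Suc n)"
    let ?R = "\<lambda>k. ln (fact (n + k)) - stirling_sum m (x + real k) h"
    have step: "\<bar>?R (Suc k) - ?R k\<bar> \<le> C * (1 / (x + real k) ^ m - 1 / (x + real (Suc k)) ^ m)" for k
    proof -
      have pos: "x + real k \<ge> \<delta>" "x + real k > 0" using x assms by auto
      have "ln (fact (n + Suc k) :: real) = ln (real (Suc (n + k)) * fact (n + k))" by simp
      also have "\<dots> = ln (x + real k + h) + ln (fact (n + k))"
        using n by (subst ln_mult) (auto simp: algebra_simps)
      finally have "\<bar>?R (Suc k) - ?R k\<bar> =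
        \<bar>ln (x + real k + h) - (stirling_sum m (x + real k + 1) h - stirling_sum m (x + real k) h)\<bar>"
        by (simp add: algebra_simps)
      also have "\<dots> \<le> C0 * (1 / (x + real k) ^ Suc m)"
        using C0(2)[of "x + real k" h] pos h by simp
      also have "\<dots> \<le> C0 * ((1 + 1 / \<delta>) ^ Suc m * (1 / (x + real k) ^ m - 1 / (x + real k + 1) ^ m))"
        by (intro mult_left_mono inverse_power_diff_ge C0 assms pos)
      finally show ?thesis by (simp add: C_def algebra_simps)
    qed
    show "\<bar>?R k - (ln (fact n) - stirling_sum m x h)\<bar> \<le> C * (1 / x ^ m - 1 / (x + real k) ^ m)"
    proof (induction k)
      case (Suc k)
      have "\<bar>?R (Suc k) - (ln (fact n) - stirling_sum m x h)\<bar> \<le>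
          \<bar>?R (Suc k) - ?R k\<bar> + \<bar>?R k - (ln (fact n) - stirling_sum m x h)\<bar>" by linarith
      also have "\<dots> \<le> C * (1 / (x + real k) ^ m - 1 / (x + real (Suc k)) ^ m) +
          C * (1 / x ^ m - 1 / (x + real k) ^ m)"
        by (intro add_mono step Suc.IH)
      finally show ?case by (simp add: algebra_simps)
    qed simp
  qed
qed

section \<open>The constant in Stirling's formula\<close>

lemma wallis_prod_eq:
  "(\<Prod>k=1..n. (4 * real k ^ 2) / (4 * real k ^ 2 - 1)) =
    (2 ^ (2 * n) * fact n ^ 2 / fact (2 * n)) ^ 2 / (2 * real n + 1)"
proof (induction n)
  case (Suc n)
  have "4 * real (Suc n) ^ 2 - 1 = (2 * real n + 1) * (2 * real n + 3)"
    by (simp add: power2_eq_square algebra_simps)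
  moreover have "fact (2 * Suc n) = (2 * real n + 2) * (2 * real n + 1) * fact (2 * n)"
    by (simp add: algebra_simps)
  moreover have "fact (Suc n) = (real n + 1) * fact n" by simp
  moreover have "2 ^ (2 * Suc n) = 4 * (2 ^ (2 * n) :: real)" by simp
  ultimately show ?case
    using Suc by (simp only: prod.nat_ivl_Suc')
       (simp add: divide_simps power2_eq_square power_mult_distrib; simp add: algebra_simps)
qed simp

text \<open>The increments of the sequence are O(1/n^2), so a limit L exists. Wallis' product
  evaluates the limit of 2 D(n) - D(2n), which is also 2 L - L = L.\<close>

lemma tendsto_ln_fact:
  "(\<lambda>n. ln (fact n) - ((real n + 1 / 2) * ln (real n) - real n)) \<longlonglongrightarrow> ln (2 * pi) / 2"
proof -
  define D where "D = (\<lambda>n. ln (fact n) - ((real n + 1 / 2) * ln (real n) - real n))"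
  obtain C where C: "C \<ge> 0" "\<And>x h. x > 0 \<Longrightarrow> 0 \<le> h \<Longrightarrow> h \<le> 1 \<Longrightarrow>
    \<bar>ln (x + h) - (stirling_sum 1 (x + 1) h - stirling_sum 1 x h)\<bar> \<le> C / x ^ Suc 1"
    using stirling_sum_step by blast
  \<comment> \<open>With x = n the relation x + h = n + 1 forces h = 1, and the coefficient of index
    1 is then 1/2.\<close>
  have D_eq: "D n = ln (fact n) - stirling_sum 1 (real n) 1" for n
    by (simp add: D_def stirling_sum_def algebra_simps)
  \<comment> \<open>Starting at index 1 keeps x positive, as \<open>stirling_sum_step\<close>
    demands.\<close>
  have "summable (\<lambda>n. D (Suc (Suc n)) - D (Suc n))"
  proof (rule summable_comparison_test_ev)
    show "summable (\<lambda>n. C * inverse (real (Suc n) ^ 2))"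
      by (intro summable_mult) (subst summable_Suc_iff, rule inverse_power_summable, simp)
    show "\<forall>\<^sub>F n in sequentially. norm (D (Suc (Suc n)) - D (Suc n)) \<le> C * inverse (real (Suc n) ^ 2)"
    proof (intro always_eventually allI)
      fix n
      have "fact (Suc (Suc n)) = (real (Suc n) + 1) * fact (Suc n)" by simp
      then have "ln (fact (Suc (Suc n)) :: real) = ln (real (Suc n) + 1) + ln (fact (Suc n))"
        by (simp only: ln_mult_pos fact_gt_zero of_nat_0_le_iff add_nonneg_pos zero_less_one)
      then have "D (Suc (Suc n)) - D (Suc n) = ln (real (Suc n) + 1) -
          (stirling_sum 1 (real (Suc n) + 1) 1 - stirling_sum 1 (real (Suc n)) 1)"
        by (simp add: D_eq add_ac)
      then show "norm (D (Suc (Suc n)) - D (Suc n)) \<le> C * inverse (real (Suc n) ^ 2)"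
        using C(2)[of "real (Suc n)" 1] by (simp add: field_simps power2_eq_square)
    qed
  qed
  then have "convergent (\<lambda>n. D (Suc n))"
    by (simp add: summable_iff_convergent sum_lessThan_telescope[of "\<lambda>n. D (Suc n)"]
        convergent_diff_const_right_iff)
  then obtain L where L: "D \<longlonglongrightarrow> L"
    by (auto simp: convergent_def dest: LIMSEQ_imp_Suc)
  \<comment> \<open>This combination contains ln ((n!)^2 / (2n)!), the factorial quotient in
    \<open>wallis_prod_eq\<close>; the terms n ln n and n drop out.\<close>
  have "(\<lambda>n. 2 * D n - D (2 * n)) \<longlonglongrightarrow> 2 * L - L"
    by (intro tendsto_intros L filterlim_compose[OF L]) real_asymp
  moreover have "(\<lambda>n. 2 * D n - D (2 * n)) \<longlonglongrightarrow> ln (2 * pi) / 2"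
  proof -
    define W where "W = (\<lambda>n. \<Prod>k=1..n. (4 * real k ^ 2) / (4 * real k ^ 2 - 1))"
    have "(\<lambda>n. ln (W n) / 2 + (ln (2 * real n + 1) - ln (real n) + ln 2) / 2)
       \<longlonglongrightarrow> ln (pi / 2) / 2 + ln 2"
    proof (intro tendsto_add tendsto_divide tendsto_ln tendsto_const)
      show "W \<longlonglongrightarrow> pi / 2" unfolding W_def by (rule wallis)
      show "(\<lambda>n. (ln (2 * real n + 1) - ln (real n) + ln 2) / 2) \<longlonglongrightarrow> ln 2"
        by real_asymp
    qed auto
    moreover have "ln (pi / 2) / 2 + ln 2 = ln (2 * pi) / 2"
      by (simp add: ln_div ln_mult field_simps)
    moreover have "\<forall>\<^sub>F n in sequentially. 2 * D n - D (2 * n) =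
        ln (W n) / 2 + (ln (2 * real n + 1) - ln (real n) + ln 2) / 2"
      using eventually_gt_at_top[of 0]
    proof eventually_elim
      case (elim n)
      have "ln (W n) = 2 * (2 * real n * ln 2 + 2 * ln (fact n) - ln (fact (2 * n))) - ln (2 * real n + 1)"
        unfolding W_def wallis_prod_eq
        by (simp add: ln_div ln_mult ln_realpow add_pos_nonneg algebra_simps)
      then show ?case
        using elim by (simp add: D_def ln_mult algebra_simps add_divide_distrib diff_divide_distrib)
    qed
    ultimately show ?thesis by (simp add: tendsto_cong)
  qed
  ultimately have "2 * L - L = ln (2 * pi) / 2" by (rule LIMSEQ_unique)
  then have "L = ln (2 * pi) / 2" by linarith
  with L show ?thesis by (simp add: D_def)
qed

text \<open>The terms of index at least 2 vanish in the limit. Those of index 0 and 1 at x + k agree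
  asymptotically with the classical main term at n + k = (x + k) + h - 1, so the constant depends
  neither on h nor on m.\<close>

lemma tendsto_ln_fact_stirling_sum:
  assumes "x + h = real (Suc n)" "m \<ge> 1"
  shows "(\<lambda>k. ln (fact (n + k)) - stirling_sum m (x + real k) h) \<longlonglongrightarrow> ln (2 * pi) / 2"
proof -
  obtain m' where m: "m = Suc m'" using assms by (cases m) auto
  have "(\<lambda>k. xlnx_deriv (Suc (Suc j)) (x + real k)) \<longlonglongrightarrow> 0" for j
    unfolding xlnx_deriv.simps by real_asymp
  then have "(\<lambda>k. \<Sum>j<m'. bernoulli_fps h $ Suc (Suc j) * xlnx_deriv (Suc (Suc j)) (x + real k)) \<longlonglongrightarrow>
      (\<Sum>j<m'. bernoulli_fps h $ Suc (Suc j) * 0)"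
    by (intro tendsto_intros)
  then have tail: "(\<lambda>k. \<Sum>j<m'. bernoulli_fps h $ Suc (Suc j) * xlnx_deriv (Suc (Suc j)) (x + real k)) \<longlonglongrightarrow> 0"
    by simp
  have D: "(\<lambda>k. ln (fact (n + k)) - ((real (n + k) + 1 / 2) * ln (real (n + k)) - real (n + k))) \<longlonglongrightarrow> ln (2 * pi) / 2"
    using LIMSEQ_ignore_initial_segment[OF tendsto_ln_fact, of n] by (simp add: add.commute)
  have h: "h = real n + 1 - x" using assms by simp
  have E: "(\<lambda>k. ((real (n + k) + 1 / 2) * ln (real (n + k)) - real (n + k)) -
     ((x + real k) * ln (x + real k) - (x + real k) + (h - 1 / 2) * ln (x + real k))) \<longlonglongrightarrow> 0"
    unfolding h by real_asymp
  have "stirling_sum m y h = (y * ln y - y) + (h - 1 / 2) * ln y +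
      (\<Sum>j<m'. bernoulli_fps h $ Suc (Suc j) * xlnx_deriv (Suc (Suc j)) y)" for y
    unfolding stirling_sum_def m lessThan_Suc_atMost[symmetric] sum.lessThan_Suc_shift
    by (simp del: xlnx_deriv.simps add: xlnx_deriv.simps(1,2))
  then have "(\<lambda>k. ln (fact (n + k)) - stirling_sum m (x + real k) h) =
    (\<lambda>k. (ln (fact (n + k)) - ((real (n + k) + 1 / 2) * ln (real (n + k)) - real (n + k))) +
     (((real (n + k) + 1 / 2) * ln (real (n + k)) - real (n + k)) -
     ((x + real k) * ln (x + real k) - (x + real k) + (h - 1 / 2) * ln (x + real k))) -
     (\<Sum>j<m'. bernoulli_fps h $ Suc (Suc j) * xlnx_deriv (Suc (Suc j)) (x + real k)))"
    by (simp add: fun_eq_iff)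
  with tendsto_diff[OF tendsto_add[OF D E] tail] show ?thesis by simp
qed

text \<open>Letting k tend to infinity in \<open>stirling_sum_ln_fact_diff\<close> replaces the far
  end by its limit. The result is the Stirling expansion of ln Gamma(x + h) at integer x + h,
  uniform in h.\<close>

lemma stirling_shifted:
  assumes "\<delta> > 0" "m \<ge> 1"
  obtains C where "C \<ge> 0" "\<And>n x h. 0 \<le> h \<Longrightarrow> h \<le> 1 \<Longrightarrow> x \<ge> \<delta> \<Longrightarrow> x + h = real (Suc n) \<Longrightarrow>
    \<bar>ln (fact n) - (stirling_sum m x h + ln (2 * pi) / 2)\<bar> \<le> C / x ^ m"
proof -
  obtain C where C: "C \<ge> 0" "\<And>n x h k. 0 \<le> h \<Longrightarrow> h \<le> 1 \<Longrightarrow> x \<ge> \<delta> \<Longrightarrow> x + h = real (Suc n) \<Longrightarrow>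
    \<bar>(ln (fact (n + k)) - stirling_sum m (x + real k) h) - (ln (fact n) - stirling_sum m x h)\<bar>
      \<le> C * (1 / x ^ m - 1 / (x + real k) ^ m)"
    using stirling_sum_ln_fact_diff[OF assms] by blast
  show ?thesis
  proof (rule that[OF C(1)])
    fix n x h
    assume *: "0 \<le> h" "h \<le> 1" "x \<ge> \<delta>" "x + h = real (Suc n)"
    have "\<bar>ln (2 * pi) / 2 - (ln (fact n) - stirling_sum m x h)\<bar> \<le> C / x ^ m"
    proof (rule LIMSEQ_le_const2)
      show "(\<lambda>k. \<bar>(ln (fact (n + k)) - stirling_sum m (x + real k) h) - (ln (fact n) - stirling_sum m x h)\<bar>)
         \<longlonglongrightarrow> \<bar>ln (2 * pi) / 2 - (ln (fact n) - stirling_sum m x h)\<bar>"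
        by (intro tendsto_intros tendsto_ln_fact_stirling_sum * assms)
      have "\<bar>(ln (fact (n + k)) - stirling_sum m (x + real k) h) - (ln (fact n) - stirling_sum m x h)\<bar> \<le> C / x ^ m" for k
      proof (rule order_trans[OF C(2)[OF *]])
        have "C * (1 / x ^ m - 1 / (x + real k) ^ m) \<le> C * (1 / x ^ m)"
          using * assms C by (intro mult_left_mono) auto
        then show "C * (1 / x ^ m - 1 / (x + real k) ^ m) \<le> C / x ^ m" by simp
      qed
      then show "\<exists>N. \<forall>k\<ge>N. \<bar>(ln (fact (n + k)) - stirling_sum m (x + real k) h) - (ln (fact n) - stirling_sum m x h)\<bar> \<le> C / x ^ m"
        by blast
    qed
    then show "\<bar>ln (fact n) - (stirling_sum m x h + ln (2 * pi) / 2)\<bar> \<le> C / x ^ m"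
      by linarith
  qed
qed

subsection \<open>Mean absolute deviation of the binomial distribution\<close>

text \<open>The sign of k - N p changes at \<open>v\<close>, so the sums below and from
  \<open>v\<close> on both telescope. Their outer ends \<open>T 0\<close> and
  \<open>T (Suc N)\<close> vanish, and each contributes \<open>T v\<close>.\<close>

lemma mean_abs_dev_eq_binomial:
  assumes p: "0 < p" "p < 1" and v: "v = nat \<lceil>real N * p\<rceil>"
  shows "mean_abs_dev N p = 2 * (real v * real (N choose v) * p ^ v * (1 - p) ^ (N + 1 - v))"
proof -
  \<comment> \<open>The exponent N + 1 - k carries one extra factor 1 - p and is a genuine
    subtraction up to k = N + 1.\<close>
  define T where "T = (\<lambda>k. real k * real (N choose k) * p ^ k * (1 - p) ^ (N + 1 - k))"
  have step: "real (N choose k) * p ^ k * (1 - p) ^ (N - k) * (real k - real N * p) = T k - T (Suc k)"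
    if "k \<le> N" for k
  proof -
    have "Suc k * (N choose Suc k) = (N - k) * (N choose k)"
      by (simp only: binomial_absorption binomial_absorb_comp)
    then have "real (Suc k) * real (N choose Suc k) = (real N - real k) * real (N choose k)"
      using that by (simp only: of_nat_mult[symmetric] of_nat_diff[symmetric])
    then have "T (Suc k) = (real N - real k) * real (N choose k) * (p * p ^ k) * (1 - p) ^ (N - k)"
      by (simp only: T_def power_Suc) simp
    moreover have "T k = real k * real (N choose k) * p ^ k * ((1 - p) * (1 - p) ^ (N - k))"
      using that by (simp add: T_def Suc_diff_le)
    ultimately show ?thesis by (simp add: algebra_simps)
  qed
  have "real N * p \<le> real N" using p by (simp add: mult_left_le)
  then have "v \<le> N" using v by (simp add: nat_le_iff ceiling_le_iff)
  have "mean_abs_dev N p =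
      (\<Sum>k\<le>N. real (N choose k) * p ^ k * (1 - p) ^ (N - k) * \<bar>real k - real N * p\<bar>)"
    unfolding mean_abs_dev_def using p by (subst expectation_binomial_pmf') auto
  also have "{..N} = {..<v} \<union> {v..<Suc N}" using \<open>v \<le> N\<close> by auto
  also have "(\<Sum>k\<in>{..<v} \<union> {v..<Suc N}. real (N choose k) * p ^ k * (1 - p) ^ (N - k) * \<bar>real k - real N * p\<bar>)
    = (\<Sum>k<v. real (N choose k) * p ^ k * (1 - p) ^ (N - k) * \<bar>real k - real N * p\<bar>)
    + (\<Sum>k=v..<Suc N. real (N choose k) * p ^ k * (1 - p) ^ (N - k) * \<bar>real k - real N * p\<bar>)"
    by (rule sum.union_disjoint) auto
  also have "(\<Sum>k<v. real (N choose k) * p ^ k * (1 - p) ^ (N - k) * \<bar>real k - real N * p\<bar>)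
     = (\<Sum>k<v. T (Suc k) - T k)"
  proof (intro sum.cong refl)
    fix k assume "k \<in> {..<v}"
    then have "k < v" by simp
    then have "int k < \<lceil>real N * p\<rceil>" "k \<le> N"
      using v \<open>v \<le> N\<close> by linarith+
    then show "real (N choose k) * p ^ k * (1 - p) ^ (N - k) * \<bar>real k - real N * p\<bar> = T (Suc k) - T k"
      using step[of k] by (simp add: less_ceiling_iff abs_if algebra_simps)
  qed
  also have "(\<Sum>k<v. T (Suc k) - T k) = T v"
    by (simp add: sum_lessThan_telescope) (simp add: T_def)
  also have "(\<Sum>k=v..<Suc N. real (N choose k) * p ^ k * (1 - p) ^ (N - k) * \<bar>real k - real N * p\<bar>)
     = (\<Sum>k=v..<Suc N. - (T (Suc k) - T k))"
  proof (intro sum.cong refl)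
    fix k assume "k \<in> {v..<Suc N}"
    then have "v \<le> k" "k \<le> N" by auto
    then have "\<lceil>real N * p\<rceil> \<le> int k" using v by linarith
    then show "real (N choose k) * p ^ k * (1 - p) ^ (N - k) * \<bar>real k - real N * p\<bar> = - (T (Suc k) - T k)"
      using step[of k] \<open>k \<le> N\<close> by (simp add: ceiling_le_iff)
  qed
  also have "\<dots> = T v"
    using \<open>v \<le> N\<close> by (subst sum_negf, subst sum_Suc_diff') (auto simp: T_def)
  finally show ?thesis by (simp add: T_def)
qed

text \<open>Cancelling v = n + 1 against v! and splitting N off N! leaves three factorials to which
  \<open>stirling_shifted\<close> applies, with x equal to N p, N (1 - p) and N.\<close>

lemma mean_abs_dev_eq_fact:
  assumes p: "0 < p" "p < 1" and N: "N \<ge> 1" and v: "Suc n = nat \<lceil>real N * p\<rceil>"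
  shows "mean_abs_dev N p =
    2 * p ^ Suc n * (1 - p) ^ (N - n) * (real N * fact (N - 1)) / (fact n * fact (N - Suc n))"
proof -
  have "real N * p \<le> real N" using p by (simp add: mult_left_le)
  then have "Suc n \<le> N" using v by (simp add: nat_le_iff ceiling_le_iff)
  have "real (N choose Suc n) = fact N / (fact (Suc n) * fact (N - Suc n))"
    using \<open>Suc n \<le> N\<close> by (rule binomial_fact)
  moreover have "fact N = real N * fact (N - 1)" using N by (simp add: fact_reduce)
  ultimately show ?thesis
    using N by (simp add: mean_abs_dev_eq_binomial[OF p v] del: of_nat_Suc)
qed

section \<open>The logarithm of the mean absolute deviation\<close>

lemma stirling_sum_Suc:
  "stirling_sum (Suc M) x h = x * ln x - x + (h - 1 / 2) * ln x +
    (\<Sum>k=1..M. (-1) ^ (k + 1) / (real k * real (k + 1)) * bernoulli_poly (k + 1) h / x ^ k)"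
proof -
  \<comment> \<open>The term of derivative index k + 1 carries (k-1)! / (k+1)! = 1 / (k
    (k+1)).\<close>
  have "(\<Sum>j<M. bernoulli_fps h $ Suc (Suc j) * xlnx_deriv (Suc (Suc j)) x) =
     (\<Sum>k=1..M. (-1) ^ (k + 1) / (real k * real (k + 1)) * bernoulli_poly (k + 1) h / x ^ k)"
    by (rule sum.reindex_bij_witness[of _ "\<lambda>k. k - 1" Suc])
      (auto simp: bernoulli_poly_eq divide_simps)
  then show ?thesis
    unfolding stirling_sum_def lessThan_Suc_atMost[symmetric] sum.lessThan_Suc_shift
    by (simp del: xlnx_deriv.simps add: xlnx_deriv.simps(1,2))
qed

text \<open>Reflection absorbs the sign (-1)^(k+1) into the shift 1 - h. Thus \<open>a_coeff\<close>
  combines the Stirling coefficients of the three factorials, with shifts 0, h and 1 - h; the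
  logarithms compensate for the terms of index 0 and 1.\<close>

lemma sum_a_coeff:
  assumes p: "0 < p" "p < 1" and N: "N \<ge> 1"
  shows "(\<Sum>k=1..M. a_coeff k h p / real N ^ k) =
    stirling_sum (Suc M) N 0 - stirling_sum (Suc M) (N * p) h - stirling_sum (Suc M) (N * (1 - p)) (1 - h)
    + (real N * p + h - 1 / 2) * ln p + (real N * (1 - p) + (1 - h) - 1 / 2) * ln (1 - p) + ln N / 2"
proof -
  define c where "c = (\<lambda>k. (-1) ^ (k + 1) / (real k * real (k + 1)))"
  have "a_coeff k h p / real N ^ k = c k * bernoulli_poly (k + 1) 0 / real N ^ k
      - c k * bernoulli_poly (k + 1) h / (real N * p) ^ k
      - c k * bernoulli_poly (k + 1) (1 - h) / (real N * (1 - p)) ^ k" for k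
  proof -
    have "bernoulli_poly (k + 1) (1 - h) = (-1) ^ (k + 1) * bernoulli_poly (k + 1) h"
      unfolding bernoulli_poly_eq bernoulli_fps_reflect by (rule mult.left_commute)
    moreover have "p powi (- int k) = 1 / p ^ k" "(1 - p) powi (- int k) = 1 / (1 - p) ^ k"
      by (simp_all add: power_int_minus inverse_eq_divide)
    moreover have "a_coeff k h p = c k * (bernoulli_poly (k + 1) 0 -
        (p powi (- int k) + (-1) ^ (k + 1) * (1 - p) powi (- int k)) * bernoulli_poly (k + 1) h)"
      by (simp only: a_coeff_def c_def bernoulli_number_def)
    ultimately show ?thesis
      by (simp only: power_mult_distrib) (simp add: algebra_simps diff_divide_distrib add_divide_distrib)
  qed
  then have "(\<Sum>k=1..M. a_coeff k h p / real N ^ k) =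
      (\<Sum>k=1..M. c k * bernoulli_poly (k + 1) 0 / real N ^ k)
      - (\<Sum>k=1..M. c k * bernoulli_poly (k + 1) h / (real N * p) ^ k)
      - (\<Sum>k=1..M. c k * bernoulli_poly (k + 1) (1 - h) / (real N * (1 - p)) ^ k)"
    by (simp add: sum_subtractf)
  moreover have "ln (real N * p) = ln N + ln p" "ln (real N * (1 - p)) = ln N + ln (1 - p)"
    using p N by (auto simp: ln_mult)
  ultimately show ?thesis
    unfolding stirling_sum_Suc c_def by (simp add: algebra_simps)
qed

lemma ln_mean_abs_dev_expansion:
  assumes "\<delta> > 0"
  obtains C where "C \<ge> 0" "\<And>N p. N \<ge> 1 \<Longrightarrow> \<delta> \<le> p \<Longrightarrow> p \<le> 1 - \<delta> \<Longrightarrow>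
    \<exists>r. \<bar>r\<bar> \<le> C / real N ^ (M + 1) \<and>
      mean_abs_dev N p = lead N p * exp ((\<Sum>k=1..M. a_coeff k (hN N p) p / real N ^ k) + r)"
proof -
  \<comment> \<open>The minimum with 1 lets one constant serve x = N >= 1 as well as x = N p and x =
    N (1 - p).\<close>
  obtain C1 where C1: "C1 \<ge> 0" "\<And>n x h. 0 \<le> h \<Longrightarrow> h \<le> 1 \<Longrightarrow> x \<ge> min \<delta> 1 \<Longrightarrow> x + h = real (Suc n) \<Longrightarrow>
    \<bar>ln (fact n) - (stirling_sum (Suc M) x h + ln (2 * pi) / 2)\<bar> \<le> C1 / x ^ Suc M"
    using stirling_shifted[of "min \<delta> 1" "Suc M"] assms by auto
  \<comment> \<open>One error comes from (N - 1)!; the two others have x >= N \<delta>, hence the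
    powers of \<delta>.\<close>
  define C where "C = C1 * (1 + 2 / \<delta> ^ Suc M)"
  show ?thesis
  proof (rule that[of C])
    show "C \<ge> 0" using C1 assms by (simp add: C_def)
    fix N :: nat and p :: real
    assume N: "N \<ge> 1" and p_ge: "\<delta> \<le> p" and p_le: "p \<le> 1 - \<delta>"
    have p: "0 < p" "p < 1" using assms p_ge p_le by auto
    define h where "h = hN N p"
    have h: "0 \<le> h" "h \<le> 1"
      using ceiling_correct[of "real N * p"] by (auto simp: h_def hN_def)
    have "\<lceil>real N * p\<rceil> > 0" using p N by simp
    then obtain n where n: "Suc n = nat \<lceil>real N * p\<rceil>"
      by (metis gr0_conv_Suc zero_less_nat_eq)
    then have "int (Suc n) = \<lceil>real N * p\<rceil>" by linarith
    then have xh: "real N * p + h = real (Suc n)"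
      by (metis add.commute diff_add_cancel h_def hN_def of_int_of_nat_eq)
    have "real N * p \<le> real N" using p by (simp add: mult_left_le)
    then have "Suc n \<le> N" using n by (simp add: nat_le_iff ceiling_le_iff)
    then have yh: "real N * (1 - p) + (1 - h) = real (Suc (N - Suc n))"
      using xh by (simp add: of_nat_diff algebra_simps)
    define rx where "rx = ln (fact n) - (stirling_sum (Suc M) (N * p) h + ln (2 * pi) / 2)"
    define ry where "ry = ln (fact (N - Suc n)) - (stirling_sum (Suc M) (N * (1 - p)) (1 - h) + ln (2 * pi) / 2)"
    define rN where "rN = ln (fact (N - 1)) - (stirling_sum (Suc M) N 0 + ln (2 * pi) / 2)"
    have bound: "\<bar>ln (fact n) - (stirling_sum (Suc M) (N * q) h + ln (2 * pi) / 2)\<bar> \<le>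
        (C1 / \<delta> ^ Suc M) / real N ^ Suc M"
      if "0 \<le> h" "h \<le> 1" "q \<ge> \<delta>" "real N * q + h = real (Suc n)" for h q :: real and n :: nat
    proof (rule order_trans[OF C1(2)])
      have "1 * \<delta> \<le> real N * q"
        using N that assms by (intro mult_mono) auto
      then show "min \<delta> 1 \<le> real N * q" by simp
      have "C1 / (real N * q) ^ Suc M \<le> C1 / (real N * \<delta>) ^ Suc M"
        using C1(1) N assms that by (intro divide_left_mono power_mono mult_left_mono) auto
      then show "C1 / (real N * q) ^ Suc M \<le> C1 / \<delta> ^ Suc M / real N ^ Suc M"
        by (simp only: power_mult_distrib divide_divide_eq_left mult.commute)
    qed (use that in auto)
    have rx: "\<bar>rx\<bar> \<le> (C1 / \<delta> ^ Suc M) / real N ^ Suc M"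
      unfolding rx_def by (rule bound) (use h p_ge xh in auto)
    have ry: "\<bar>ry\<bar> \<le> (C1 / \<delta> ^ Suc M) / real N ^ Suc M"
      unfolding ry_def by (rule bound) (use h p_le yh in auto)
    have rN: "\<bar>rN\<bar> \<le> C1 / real N ^ Suc M"
      unfolding rN_def by (rule C1(2)) (use N in auto)
    have lead_pos: "lead N p > 0" using N p by (simp add: lead_def)
    have mad: "mean_abs_dev N p =
        2 * p ^ Suc n * (1 - p) ^ (N - n) * (real N * fact (N - 1)) / (fact n * fact (N - Suc n))"
      by (rule mean_abs_dev_eq_fact[OF p N n])
    have mad_pos: "mean_abs_dev N p > 0"
      unfolding mad using p N by (intro divide_pos_pos mult_pos_pos) auto
    have "ln (mean_abs_dev N p) = ln 2 + real (Suc n) * ln p + real (N - n) * ln (1 - p) + ln (real N)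
        + ln (fact (N - 1)) - ln (fact n) - ln (fact (N - Suc n))"
      unfolding mad using p N
      by (simp add: ln_div ln_mult ln_realpow del: power_Suc of_nat_Suc)
    also have "real (N - n) = real N * (1 - p) + (1 - h)"
      using yh \<open>Suc n \<le> N\<close> by (simp add: Suc_diff_Suc)
    finally have 1: "ln (mean_abs_dev N p) =
        ln 2 + (real N * p + h) * ln p + (real N * (1 - p) + (1 - h)) * ln (1 - p) + ln (real N)
        + ln (fact (N - 1)) - ln (fact n) - ln (fact (N - Suc n))"
      by (simp only: xh)
    have 2: "ln (lead N p) = (ln 2 + ln (real N) + ln p + ln (1 - p) - ln pi) / 2"
      unfolding lead_def using p N by (simp add: ln_sqrt ln_div ln_mult)
    have "ln (2 * pi) = ln 2 + ln pi" by (simp add: ln_mult)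
    then have "ln (mean_abs_dev N p) = ln (lead N p) +
        ((\<Sum>k=1..M. a_coeff k h p / real N ^ k) + (rN - rx - ry))"
      unfolding 1 2 sum_a_coeff[OF p N] rN_def rx_def ry_def
      by (simp add: algebra_simps add_divide_distrib diff_divide_distrib)
    then have "exp (ln (mean_abs_dev N p)) = exp (ln (lead N p) +
        ((\<Sum>k=1..M. a_coeff k h p / real N ^ k) + (rN - rx - ry)))"
      by (rule arg_cong)
    then have "mean_abs_dev N p = lead N p *
        exp ((\<Sum>k=1..M. a_coeff k h p / real N ^ k) + (rN - rx - ry))"
      using lead_pos mad_pos by (simp only: exp_add[of "ln _"] exp_ln)
    moreover have "\<bar>rN - rx - ry\<bar> \<le> C1 / real N ^ Suc M + (C1 / \<delta> ^ Suc M) / real N ^ Suc M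
        + (C1 / \<delta> ^ Suc M) / real N ^ Suc M"
      using rx ry rN by linarith
    moreover have "\<dots> = C / real N ^ (M + 1)"
      by (simp add: C_def algebra_simps add_divide_distrib)
    ultimately show "\<exists>r. \<bar>r\<bar> \<le> C / real N ^ (M + 1) \<and>
        mean_abs_dev N p = lead N p * exp ((\<Sum>k=1..M. a_coeff k (hN N p) p / real N ^ k) + r)"
      unfolding h_def[symmetric] by (intro exI[of _ "rN - rx - ry"] conjI) simp_all
  qed
qed

subsection \<open>Exponentials of truncated expansions\<close>

text \<open>Bounding k by m cancels the factor m, and the geometric sum A (1 + (1+A) + ... +
  (1+A)^(m-1)) = (1+A)^m - 1 closes the induction.\<close>

lemma exp_recurrence_bound:
  fixes a d :: "nat \<Rightarrow> real"
  assumes a: "\<And>k. 1 \<le> k \<Longrightarrow> k \<le> M \<Longrightarrow> \<bar>a k\<bar> \<le> A" and "A \<ge> 0"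
    and d0: "d 0 = 1"
    and d: "\<And>m. 1 \<le> m \<Longrightarrow> m \<le> M \<Longrightarrow> real m * d m = (\<Sum>k=1..m. real k * a k * d (m - k))"
  shows "m \<le> M \<Longrightarrow> \<bar>d m\<bar> \<le> (1 + A) ^ m"
proof (induction m rule: less_induct)
  case (less m)
  show ?case
  proof (cases "m = 0")
    case False
    have "real m * \<bar>d m\<bar> = \<bar>real m * d m\<bar>" by (simp add: abs_mult)
    also have "real m * d m = (\<Sum>k=1..m. real k * a k * d (m - k))"
      using False less.prems by (intro d) auto
    also have "\<bar>\<Sum>k=1..m. real k * a k * d (m - k)\<bar> \<le> (\<Sum>k=1..m. \<bar>real k * a k * d (m - k)\<bar>)"
      by (rule sum_abs)
    also have "\<dots> \<le> (\<Sum>k=1..m. real m * (A * (1 + A) ^ (m - k)))"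
    proof (rule sum_mono)
      fix k assume k: "k \<in> {1..m}"
      have "real k * (\<bar>a k\<bar> * \<bar>d (m - k)\<bar>) \<le> real m * (A * (1 + A) ^ (m - k))"
        using k less.prems \<open>A \<ge> 0\<close> by (intro mult_mono a less.IH) auto
      then show "\<bar>real k * a k * d (m - k)\<bar> \<le> real m * (A * (1 + A) ^ (m - k))"
        by (simp add: abs_mult mult.assoc)
    qed
    also have "\<dots> = real m * (A * (\<Sum>i<m. (1 + A) ^ i))"
      unfolding sum_distrib_left
      by (rule sum.reindex_bij_witness[of _ "\<lambda>i. m - i" "\<lambda>k. m - k"]) auto
    also have "A * (\<Sum>i<m. (1 + A) ^ i) = (1 + A) ^ m - 1"
      using power_diff_1_eq[of "1 + A" m] by simp
    finally show ?thesis using False by simp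
  qed (use d0 in simp)
qed

lemma abs_exp_minus_1_le: "\<bar>exp r - 1\<bar> \<le> \<bar>r\<bar> * exp \<bar>r\<bar>" for r :: real
proof (cases "r \<ge> 0")
  case True
  have "exp r * (1 - r) \<le> exp r * exp (- r)"
    using exp_ge_add_one_self[of "- r"] by (intro mult_left_mono) auto
  then show ?thesis using True by (simp add: algebra_simps flip: exp_add)
next
  case False
  then have "exp r \<le> 1" by simp
  then have "\<bar>exp r - 1\<bar> \<le> \<bar>r\<bar> * 1"
    using exp_ge_add_one_self[of r] by linarith
  also have "\<dots> \<le> \<bar>r\<bar> * exp \<bar>r\<bar>" by (intro mult_left_mono) auto
  finally show ?thesis .
qed

text \<open>The recurrence says that \<open>P = \<Sum>\<^sub>n d n z\<^sup>n\<close> solves \<open>P' = T' P\<close> for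
  \<open>T = \<Sum>\<^sub>k a k z\<^sup>k\<close> up to order \<open>z\<^sup>M\<close>, so that \<open>P exp (- T)\<close> is almost constant.\<close>

lemma exp_poly_expansion:
  fixes A :: real
  assumes "A \<ge> 0"
  obtains C where "C \<ge> 0" "\<And>a d z. \<lbrakk>\<And>k. 1 \<le> k \<Longrightarrow> k \<le> M \<Longrightarrow> \<bar>a k\<bar> \<le> A; d 0 = 1;
      \<And>m. 1 \<le> m \<Longrightarrow> m \<le> M \<Longrightarrow> real m * d m = (\<Sum>k=1..m. real k * a k * d (m - k));
      0 < z; z \<le> 1\<rbrakk> \<Longrightarrow>
    \<bar>exp (\<Sum>k=1..M. a k * z ^ k) - (\<Sum>n\<le>M. d n * z ^ n)\<bar> \<le> C * z ^ (M + 1)"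
proof -
  define D where "D = (1 + A) ^ M"
  \<comment> \<open>There are (M + 1)^2 index pairs, each with a coefficient product of at most M A
    D.\<close>
  define C1 where "C1 = (real M + 1) * ((real M + 1) * (real M * A * D))"
  \<comment> \<open>One exponential bounds exp (- T) at the intermediate point, the other bounds exp
    (T z) when the estimate is multiplied back.\<close>
  define C where "C = exp (real M * A) * (exp (real M * A) * C1)"
  have D: "D \<ge> 0" using assms by (simp add: D_def)
  have C1: "C1 \<ge> 0" using assms D by (simp add: C1_def)
  show ?thesis
  proof (rule that[of C])
    show "C \<ge> 0" using C1 by (simp add: C_def)
    fix a d :: "nat \<Rightarrow> real" and z :: real
    assume a: "\<And>k. 1 \<le> k \<Longrightarrow> k \<le> M \<Longrightarrow> \<bar>a k\<bar> \<le> A" and d0: "d 0 = 1"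
      and d: "\<And>m. 1 \<le> m \<Longrightarrow> m \<le> M \<Longrightarrow> real m * d m = (\<Sum>k=1..m. real k * a k * d (m - k))"
      and z: "0 < z" "z \<le> 1"
    \<comment> \<open>These are the coefficients of z T'(z).\<close>
    define e where "e = (\<lambda>k. if 1 \<le> k then real k * a k else 0)"
    define T T' P P' where "T = (\<lambda>z. \<Sum>k=1..M. a k * z ^ k)"
      and "T' = (\<lambda>z. \<Sum>k=1..M. a k * (real k * z ^ (k - 1)))"
      and "P = (\<lambda>z. \<Sum>n\<le>M. d n * z ^ n)"
      and "P' = (\<lambda>z. \<Sum>n\<le>M. d n * (real n * z ^ (n - 1)))"
    have d_le: "\<bar>d n\<bar> \<le> D" if "n \<le> M" for n
    proof -
      have "\<bar>d n\<bar> \<le> (1 + A) ^ n"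
        using exp_recurrence_bound[of M a A d n] a assms d0 d that by blast
      also have "\<dots> \<le> D" unfolding D_def using assms that by (intro power_increasing) auto
      finally show ?thesis .
    qed
    have e_le: "\<bar>e k\<bar> \<le> real M * A" if "k \<le> M" for k
      using a[of k] that assms by (auto simp: e_def abs_mult intro!: mult_mono)
    have T_le: "\<bar>T y\<bar> \<le> real M * A" if "0 \<le> y" "y \<le> 1" for y
    proof -
      have "\<bar>T y\<bar> \<le> (\<Sum>k=1..M. \<bar>a k * y ^ k\<bar>)" unfolding T_def by (rule sum_abs)
      also have "\<dots> \<le> (\<Sum>k=1..M. A)"
      proof (rule sum_mono)
        fix k assume "k \<in> {1..M}"
        then have "\<bar>a k\<bar> * y ^ k \<le> A * 1"
          using that a assms by (intro mult_mono power_le_one) auto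
        then show "\<bar>a k * y ^ k\<bar> \<le> A" using that by (simp add: abs_mult)
      qed
      finally show ?thesis by simp
    qed
    \<comment> \<open>After multiplication by y the recurrence cancels all terms of degree at most
      M. The surviving pairs have k + n >= M + 1, and dividing by y leaves y^M.\<close>
    have ode: "\<bar>P' y - T' y * P y\<bar> \<le> C1 * y ^ M" if y: "0 < y" "y \<le> 1" for y
    proof -
      let ?g = "\<lambda>k n. e k * d n * y ^ (k + n)"
      let ?lo = "{(k, n). k + n \<le> M}" and ?all = "{..M} \<times> {..M}"
      have yP': "y * P' y = (\<Sum>m\<le>M. real m * d m * y ^ m)"
        unfolding P'_def sum_distrib_left
      proof (intro sum.cong refl)
        fix n
        show "y * (d n * (real n * y ^ (n - 1))) = real n * d n * y ^ n" by (cases n) auto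
      qed
      have yT': "y * T' y = (\<Sum>k\<le>M. e k * y ^ k)"
        unfolding T'_def sum_distrib_left
      proof (rule sum.mono_neutral_cong_left)
        fix k assume "k \<in> {1..M}"
        then show "y * (a k * (real k * y ^ (k - 1))) = e k * y ^ k" by (cases k) (auto simp: e_def)
      qed (auto simp: e_def)
      have "y * T' y * P y = (\<Sum>k\<le>M. \<Sum>n\<le>M. ?g k n)"
        unfolding yT' P_def sum_product
        by (intro sum.cong refl) (simp add: power_add)
      also have "\<dots> = (\<Sum>(k, n)\<in>?all. ?g k n)" by (rule sum.cartesian_product)
      also have "\<dots> = (\<Sum>(k, n)\<in>?all - ?lo. ?g k n) + (\<Sum>(k, n)\<in>?lo. ?g k n)"
        by (rule sum.subset_diff) auto
      also have "(\<Sum>(k, n)\<in>?lo. ?g k n) = (\<Sum>m\<le>M. \<Sum>k\<le>m. ?g k (m - k))"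
        by (rule sum.triangle_reindex_eq)
      also have "\<dots> = (\<Sum>m\<le>M. real m * d m * y ^ m)"
      proof (intro sum.cong refl)
        fix m assume m: "m \<in> {..M}"
        have "(\<Sum>k\<le>m. ?g k (m - k)) = (\<Sum>k=1..m. real k * a k * d (m - k) * y ^ m)"
          by (rule sum.mono_neutral_cong_right) (auto simp: e_def)
        also have "\<dots> = real m * d m * y ^ m"
          using m d[of m] by (cases "m = 0") (simp_all add: sum_distrib_right)
        finally show "(\<Sum>k\<le>m. ?g k (m - k)) = real m * d m * y ^ m" .
      qed
      finally have yQ: "y * (P' y - T' y * P y) = - (\<Sum>(k, n)\<in>?all - ?lo. ?g k n)"
        unfolding right_diff_distrib yP' by (simp add: mult.assoc)
      have "y * \<bar>P' y - T' y * P y\<bar> = \<bar>y * (P' y - T' y * P y)\<bar>"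
        using y by (simp only: abs_mult abs_of_pos)
      also have "\<dots> = \<bar>\<Sum>(k, n)\<in>?all - ?lo. ?g k n\<bar>"
        by (simp only: yQ abs_minus_cancel)
      also have "\<dots> \<le> (\<Sum>(k, n)\<in>?all - ?lo. \<bar>?g k n\<bar>)"
        unfolding case_prod_unfold by (rule sum_abs)
      also have "\<dots> \<le> (\<Sum>(k, n)\<in>?all - ?lo. real M * A * D * y ^ Suc M)"
      proof (rule sum_mono)
        fix kn assume "kn \<in> ?all - ?lo"
        then obtain k n where kn: "kn = (k, n)" "k \<le> M" "n \<le> M" "\<not> k + n \<le> M" by auto
        have "\<bar>e k\<bar> * \<bar>d n\<bar> * y ^ (k + n) \<le> real M * A * D * y ^ Suc M"
          using kn y assms D by (intro mult_mono e_le d_le power_decreasing) auto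
        then show "(case kn of (k, n) \<Rightarrow> \<bar>?g k n\<bar>) \<le> (case kn of (k, n) \<Rightarrow> real M * A * D * y ^ Suc M)"
          using y by (simp add: kn(1) abs_mult)
      qed
      also have "\<dots> \<le> (\<Sum>(k, n)\<in>?all. real M * A * D * y ^ Suc M)"
        using y assms D by (intro sum_mono2) auto
      also have "\<dots> = y * (C1 * y ^ M)"
        by (simp add: C1_def algebra_simps)
      finally show ?thesis using y by simp
    qed
    define f where "f = (\<lambda>y. P y * exp (- T y))"
    have T_deriv: "(T has_real_derivative T' y) (at y)" for y
      unfolding T_def T'_def by (auto intro!: derivative_eq_intros sum.cong simp: mult_ac)
    have P_deriv: "(P has_real_derivative P' y) (at y)" for y
      unfolding P_def P'_def by (auto intro!: derivative_eq_intros sum.cong simp: mult_ac)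
    have "(f has_real_derivative (P' y - T' y * P y) * exp (- T y)) (at y)" for y
      unfolding f_def
      by (auto intro!: derivative_eq_intros T_deriv P_deriv simp: algebra_simps)
    \<comment> \<open>The mean value theorem supplies the last factor z of the error and an interior
      point, where the bound \<open>ode\<close> is available.\<close>
    then obtain y where y: "0 < y" "y < z" "f z - f 0 = (z - 0) * ((P' y - T' y * P y) * exp (- T y))"
      using MVT2[of 0 z f "\<lambda>y. (P' y - T' y * P y) * exp (- T y)"] z by blast
    have "P 0 = 1" "T 0 = 0"
      unfolding P_def T_def using d0 by (simp_all add: power_0_left if_distrib cong: if_cong)
    then have "f 0 = 1" by (simp add: f_def)
    have "\<bar>f z - 1\<bar> = z * (\<bar>P' y - T' y * P y\<bar> * exp (- T y))"
      using y z \<open>f 0 = 1\<close> by (simp add: abs_mult)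
    also have "\<dots> \<le> z * ((C1 * y ^ M) * exp (real M * A))"
    proof (intro mult_left_mono mult_mono)
      show "\<bar>P' y - T' y * P y\<bar> \<le> C1 * y ^ M" using ode y z by auto
      show "exp (- T y) \<le> exp (real M * A)" using T_le[of y] y z by auto
    qed (use z y C1 in auto)
    also have "\<dots> \<le> z * ((C1 * z ^ M) * exp (real M * A))"
      using y z C1 by (intro mult_left_mono mult_right_mono power_mono) auto
    finally have f: "\<bar>f z - 1\<bar> \<le> exp (real M * A) * C1 * z ^ (M + 1)" by (simp add: mult_ac)
    have "exp (T z) - P z = exp (T z) * (1 - f z)"
      by (simp add: f_def right_diff_distrib exp_minus field_simps)
    then have "\<bar>exp (T z) - P z\<bar> = exp (T z) * \<bar>f z - 1\<bar>"
      by (simp add: abs_mult abs_minus_commute)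
    also have "\<dots> \<le> exp (real M * A) * (exp (real M * A) * C1 * z ^ (M + 1))"
      using T_le[of z] z f by (intro mult_mono) auto
    finally show "\<bar>exp (\<Sum>k=1..M. a k * z ^ k) - (\<Sum>n\<le>M. d n * z ^ n)\<bar> \<le> C * z ^ (M + 1)"
      by (simp add: T_def P_def C_def mult_ac)
  qed
qed

section \<open>Recurrences for the coefficients\<close>

lemma exp_coeff_0: "exp_coeff M a 0 = 1"
  by (simp add: exp_coeff_def)

text \<open>Compare coefficients of index m - 1 in E' = t' E for E = exp t. For m <= M the
  truncation of t does not reach the terms involved.\<close>

lemma exp_coeff_recurrence:
  assumes "1 \<le> m" "m \<le> M"
  shows "real m * exp_coeff M a m = (\<Sum>k=1..m. real k * a k * exp_coeff M a (m - k))"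
proof -
  define t where "t = Abs_fps (\<lambda>k. if 1 \<le> k \<and> k \<le> M then a k else 0)"
  define E where "E = fps_exp 1 oo t"
  have t0: "t $ 0 = 0" by (simp add: t_def)
  have "fps_deriv E = E * fps_deriv t"
    unfolding E_def by (simp add: fps_compose_deriv t0)
  then have "fps_deriv E $ (m - 1) = (fps_deriv t * E) $ (m - 1)" by (simp add: mult.commute)
  then have "real m * E $ m = (\<Sum>i=0..m - 1. real (i + 1) * t $ (i + 1) * E $ (m - 1 - i))"
    using assms by (simp add: fps_mult_nth)
  also have "\<dots> = (\<Sum>k=1..m. real k * a k * E $ (m - k))"
    by (rule sum.reindex_bij_witness[of _ "\<lambda>k. k - 1" Suc]) (use assms in \<open>auto simp: t_def\<close>)
  finally show ?thesis by (simp add: E_def t_def exp_coeff_def)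
qed

lemma d_coeff_0: "d_coeff 0 h p = 1"
  by (simp add: d_coeff.simps)

lemma d_coeff_recurrence:
  "m \<ge> 1 \<Longrightarrow> real m * d_coeff m h p = (\<Sum>k=1..m. real k * a_coeff k h p * d_coeff (m - k) h p)"
  by (subst d_coeff.simps) simp

text \<open>Both sides obey the same recurrence with the same initial value, so the coefficient is
  independent of the truncation order M >= m.\<close>

lemma exp_coeff_a_coeff:
  "m \<le> M \<Longrightarrow> exp_coeff M (\<lambda>k. a_coeff k h p) m = d_coeff m h p"
proof (induction m rule: less_induct)
  case (less m)
  show ?case
  proof (cases "m = 0")
    case False
    have "real m * exp_coeff M (\<lambda>k. a_coeff k h p) m = real m * d_coeff m h p"
      using False less by (simp add: exp_coeff_recurrence d_coeff_recurrence)
    with False show ?thesis by simp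
  qed (simp add: exp_coeff_0 d_coeff_0)
qed

subsection \<open>The expansion of the mean absolute deviation\<close>

text \<open>A bound uniform in p and h makes the constant of \<open>exp_poly_expansion\<close>
  independent of N and p.\<close>

lemma a_coeff_bounded:
  assumes "\<delta> > 0"
  obtains A where "A \<ge> 0" "\<And>k h p. 1 \<le> k \<Longrightarrow> k \<le> M \<Longrightarrow> 0 \<le> h \<Longrightarrow> h \<le> 1 \<Longrightarrow> \<delta> \<le> p \<Longrightarrow> p \<le> 1 - \<delta> \<Longrightarrow>
    \<bar>a_coeff k h p\<bar> \<le> A"
proof -
  have "\<exists>B. B \<ge> 0 \<and> (\<forall>t. 0 \<le> t \<and> t \<le> 1 \<longrightarrow> \<bar>bernoulli_poly k t\<bar> \<le> B)" for k
  proof -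
    obtain B where "B \<ge> 0" "\<And>t. 0 \<le> t \<Longrightarrow> t \<le> 1 \<Longrightarrow> \<bar>bernoulli_fps t $ k\<bar> \<le> B"
      using bernoulli_fps_bounded[of k] by blast
    then show ?thesis
      by (intro exI[of _ "fact k * B"]) (auto simp: bernoulli_poly_eq abs_mult)
  qed
  then obtain B where B: "\<And>k. B k \<ge> 0" "\<And>k t. 0 \<le> t \<Longrightarrow> t \<le> 1 \<Longrightarrow> \<bar>bernoulli_poly k t\<bar> \<le> B k"
    by metis
  define A0 where "A0 = (\<lambda>k. B (k + 1) + (1 / \<delta> ^ k + 1 / \<delta> ^ k) * B (k + 1))"
  have A0: "A0 k \<ge> 0" for k using B assms by (simp add: A0_def)
  show ?thesis
  proof (rule that[of "\<Sum>k\<le>M. A0 k"])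
    show "(\<Sum>k\<le>M. A0 k) \<ge> 0" by (intro sum_nonneg A0)
    fix k :: nat and h p :: real
    assume k: "1 \<le> k" "k \<le> M" and h: "0 \<le> h" "h \<le> 1" and p: "\<delta> \<le> p" "p \<le> 1 - \<delta>"
    have powi: "\<bar>q powi (- int k)\<bar> \<le> 1 / \<delta> ^ k" if "\<delta> \<le> q" for q :: real
    proof -
      have "1 / q ^ k \<le> 1 / \<delta> ^ k" using that assms by (intro divide_left_mono power_mono) auto
      then show ?thesis using that assms by (simp add: power_int_minus inverse_eq_divide)
    qed
    have "real 1 * real 1 \<le> real k * real (k + 1)" using k by (intro mult_mono) auto
    then have c: "\<bar>(-1) ^ (k + 1) / (real k * real (k + 1))\<bar> \<le> 1"
      using k by (simp add: abs_mult divide_le_eq)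
    have s: "\<bar>p powi (- int k) + (-1) ^ (k + 1) * (1 - p) powi (- int k)\<bar> \<le> 1 / \<delta> ^ k + 1 / \<delta> ^ k"
      using powi[of p] powi[of "1 - p"] p
      by (intro order_trans[OF abs_triangle_ineq] add_mono) (auto simp: abs_mult power_abs)
    have "\<bar>a_coeff k h p\<bar> \<le> 1 * \<bar>bernoulli_number (k + 1) -
        (p powi (- int k) + (-1) ^ (k + 1) * (1 - p) powi (- int k)) * bernoulli_poly (k + 1) h\<bar>"
      unfolding a_coeff_def abs_mult[of "_ / _"] using c by (intro mult_right_mono) auto
    also have "\<dots> \<le> A0 k"
      unfolding mult_1 A0_def
    proof (rule order_trans[OF abs_triangle_ineq4], intro add_mono)
      show "\<bar>bernoulli_number (k + 1)\<bar> \<le> B (k + 1)"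
        unfolding bernoulli_number_def by (rule B) auto
      show "\<bar>(p powi (- int k) + (-1) ^ (k + 1) * (1 - p) powi (- int k)) * bernoulli_poly (k + 1) h\<bar>
          \<le> (1 / \<delta> ^ k + 1 / \<delta> ^ k) * B (k + 1)"
        unfolding abs_mult[of "_ + _"] using assms h by (intro mult_mono s B) auto
    qed
    also have "\<dots> \<le> (\<Sum>k\<le>M. A0 k)"
      using k A0 by (intro member_le_sum) auto
    finally show "\<bar>a_coeff k h p\<bar> \<le> (\<Sum>k\<le>M. A0 k)" .
  qed
qed

text \<open>With z = 1/N the error has two sources: re-expanding exp T as the polynomial P, and the
  factor exp r, which differs from 1 by at most |r| exp |r|. Here |r| <= C1 because z <= 1.\<close>

lemma mean_abs_dev_expansion_interval:
  assumes "\<delta> > 0"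
  obtains C where "\<And>N p. N \<ge> 1 \<Longrightarrow> \<delta> \<le> p \<Longrightarrow> p \<le> 1 - \<delta> \<Longrightarrow>
    \<exists>r. \<bar>r\<bar> \<le> C / real N ^ (M + 1) \<and>
      mean_abs_dev N p = lead N p * ((\<Sum>n\<le>M. d_coeff n (hN N p) p / real N ^ n) + r)"
proof -
  obtain A where A: "A \<ge> 0" "\<And>k h p. 1 \<le> k \<Longrightarrow> k \<le> M \<Longrightarrow> 0 \<le> h \<Longrightarrow> h \<le> 1 \<Longrightarrow> \<delta> \<le> p \<Longrightarrow> p \<le> 1 - \<delta> \<Longrightarrow>
      \<bar>a_coeff k h p\<bar> \<le> A"
    using a_coeff_bounded[OF assms, of M] by blast
  obtain C1 where C1: "C1 \<ge> 0" "\<And>N p. N \<ge> 1 \<Longrightarrow> \<delta> \<le> p \<Longrightarrow> p \<le> 1 - \<delta> \<Longrightarrow>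
    \<exists>r. \<bar>r\<bar> \<le> C1 / real N ^ (M + 1) \<and>
      mean_abs_dev N p = lead N p * exp ((\<Sum>k=1..M. a_coeff k (hN N p) p / real N ^ k) + r)"
    using ln_mean_abs_dev_expansion[OF assms, of M] by blast
  obtain C2 where C2: "C2 \<ge> 0" "\<And>a d z. \<lbrakk>\<And>k. 1 \<le> k \<Longrightarrow> k \<le> M \<Longrightarrow> \<bar>a k\<bar> \<le> A; d 0 = 1;
      \<And>m. 1 \<le> m \<Longrightarrow> m \<le> M \<Longrightarrow> real m * d m = (\<Sum>k=1..m. real k * a k * d (m - k));
      0 < z; z \<le> 1\<rbrakk> \<Longrightarrow>
    \<bar>exp (\<Sum>k=1..M. a k * z ^ k) - (\<Sum>n\<le>M. d n * z ^ n)\<bar> \<le> C2 * z ^ (M + 1)"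
    using exp_poly_expansion[OF A(1), of M] by blast
  define C where "C = (C2 + exp (real M * A) * (C1 * exp C1))"
  show ?thesis
  proof (rule that[of C])
    fix N :: nat and p :: real
    assume N: "N \<ge> 1" and p: "\<delta> \<le> p" "p \<le> 1 - \<delta>"
    define h where "h = hN N p"
    have h: "0 \<le> h" "h \<le> 1"
      using ceiling_correct[of "real N * p"] by (auto simp: h_def hN_def)
    define z where "z = 1 / real N"
    have z: "0 < z" "z \<le> 1" using N by (auto simp: z_def)
    define T P where "T = (\<Sum>k=1..M. a_coeff k h p * z ^ k)" and "P = (\<Sum>n\<le>M. d_coeff n h p * z ^ n)"
    obtain r where r: "\<bar>r\<bar> \<le> C1 * z ^ (M + 1)" "mean_abs_dev N p = lead N p * exp (T + r)"
      using C1(2)[OF N p] by (auto simp: T_def z_def h_def power_divide)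
    have TP: "\<bar>exp T - P\<bar> \<le> C2 * z ^ (M + 1)"
      unfolding T_def P_def
      by (rule C2(2)) (use A h p z in \<open>auto simp: d_coeff_0 d_coeff_recurrence\<close>)
    have "C1 * z ^ (M + 1) \<le> C1 * 1"
      using C1 z by (intro mult_left_mono power_le_one) auto
    then have r1: "\<bar>r\<bar> \<le> C1" using r by linarith
    have "\<bar>T\<bar> \<le> (\<Sum>k=1..M. \<bar>a_coeff k h p * z ^ k\<bar>)" unfolding T_def by (rule sum_abs)
    also have "\<dots> \<le> (\<Sum>k=1..M. A)"
    proof (rule sum_mono)
      fix k assume "k \<in> {1..M}"
      then have "\<bar>a_coeff k h p\<bar> * z ^ k \<le> A * 1"
        using A h p z by (intro mult_mono power_le_one) auto
      then show "\<bar>a_coeff k h p * z ^ k\<bar> \<le> A" using z by (simp add: abs_mult)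
    qed
    finally have T: "\<bar>T\<bar> \<le> real M * A" by simp
    have "exp (T + r) - exp T = exp T * (exp r - 1)"
      by (simp add: exp_add algebra_simps)
    then have "\<bar>exp (T + r) - exp T\<bar> = exp T * \<bar>exp r - 1\<bar>"
      by (simp add: abs_mult)
    also have "\<dots> \<le> exp (real M * A) * (C1 * z ^ (M + 1) * exp C1)"
    proof (intro mult_mono)
      show "\<bar>exp r - 1\<bar> \<le> C1 * z ^ (M + 1) * exp C1"
        by (rule order_trans[OF abs_exp_minus_1_le]) (use r r1 C1 z in \<open>intro mult_mono\<close>; auto)
    qed (use T in auto)
    finally have "\<bar>exp (T + r) - P\<bar> \<le> C * z ^ (M + 1)"
      using TP by (simp add: C_def algebra_simps)
    then show "\<exists>r. \<bar>r\<bar> \<le> C / real N ^ (M + 1) \<and>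
        mean_abs_dev N p = lead N p * ((\<Sum>n\<le>M. d_coeff n (hN N p) p / real N ^ n) + r)"
      using r(2) by (intro exI[of _ "exp (T + r) - P"])
        (simp add: P_def z_def h_def power_divide)
  qed
qed

lemma compact_unit_interval_bounds:
  fixes K :: "real set"
  assumes "compact K" "K \<subseteq> {0<..<1}"
  obtains \<delta> where "\<delta> > 0" "\<And>p. p \<in> K \<Longrightarrow> \<delta> \<le> p \<and> p \<le> 1 - \<delta>"
proof (cases "K = {}")
  case True
  then show ?thesis using that[of 1] by simp
next
  case False
  obtain a where a: "a \<in> K" "\<And>p. p \<in> K \<Longrightarrow> a \<le> p"
    using compact_attains_inf[OF assms(1) False] by blast
  obtain b where b: "b \<in> K" "\<And>p. p \<in> K \<Longrightarrow> p \<le> b"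
    using compact_attains_sup[OF assms(1) False] by blast
  show ?thesis
  proof (rule that[of "min a (1 - b)"])
    show "min a (1 - b) > 0" using a(1) b(1) assms(2) by auto
    show "min a (1 - b) \<le> p \<and> p \<le> 1 - min a (1 - b)" if "p \<in> K" for p
      using a(2)[OF that] b(2)[OF that] by linarith
  qed
qed

lemma mean_abs_dev_expansion:
  "asymp_expansion mean_abs_dev lead (\<lambda>m N p. d_coeff m (hN N p) p)"
  unfolding asymp_expansion_def
proof (intro allI impI, elim conjE)
  fix M :: nat and K :: "real set"
  assume "compact K" "K \<subseteq> {0<..<1}"
  then obtain \<delta> where \<delta>: "\<delta> > 0" "\<And>p. p \<in> K \<Longrightarrow> \<delta> \<le> p \<and> p \<le> 1 - \<delta>"
    using compact_unit_interval_bounds by blast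
  show "\<exists>C. \<forall>N\<ge>1. \<forall>p\<in>K. \<exists>r. \<bar>r\<bar> \<le> C / real N ^ (M + 1) \<and>
      mean_abs_dev N p = lead N p * ((\<Sum>n\<le>M. d_coeff n (hN N p) p / real N ^ n) + r)"
    using mean_abs_dev_expansion_interval[OF \<delta>(1), of M] \<delta>(2) by metis
qed

text \<open>The constant 1 in this crude bound lets the relative and the absolute remainder share
  one C.\<close>

lemma lead_le_sqrt:
  assumes "0 < p" "p < 1"
  shows "lead N p \<le> sqrt (real N)"
proof -
  have "p * (1 - p) \<le> 1 * 1" using assms by (intro mult_mono) auto
  then have "2 * (p * (1 - p)) \<le> pi" using pi_ge_two by linarith
  then have "real N * (2 * (p * (1 - p)) / pi) \<le> real N * 1"
    by (intro mult_left_mono) auto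
  then show ?thesis by (simp add: lead_def mult_ac)
qed

lemma mean_abs_dev_expansion_absolute:
  assumes "compact K" "K \<subseteq> {0<..<1}"
  shows "\<exists>C. \<forall>N\<ge>1. \<forall>p\<in>K. \<exists>r.
    mean_abs_dev N p = lead N p * ((\<Sum>m = 0..M. d_coeff m (hN N p) p / real N ^ m) + r) \<and>
    \<bar>r\<bar> \<le> C / real N ^ (M + 1) \<and> \<bar>lead N p * r\<bar> \<le> C * real N powr (- real M - 1 / 2)"
proof -
  obtain C where C: "\<And>N p. N \<ge> 1 \<Longrightarrow> p \<in> K \<Longrightarrow> \<exists>r. \<bar>r\<bar> \<le> C / real N ^ (M + 1) \<and>
      mean_abs_dev N p = lead N p * ((\<Sum>n\<le>M. d_coeff n (hN N p) p / real N ^ n) + r)"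
    using mean_abs_dev_expansion assms unfolding asymp_expansion_def by metis
  have "\<bar>lead N p * r\<bar> \<le> C * real N powr (- real M - 1 / 2)"
    if N: "N \<ge> 1" and p: "p \<in> K" and r: "\<bar>r\<bar> \<le> C / real N ^ (M + 1)" for N p r
  proof -
    have p01: "0 < p" "p < 1" using p assms by auto
    then have "lead N p \<ge> 0" by (simp add: lead_def)
    then have "\<bar>lead N p * r\<bar> \<le> sqrt (real N) * (C / real N ^ (M + 1))"
      unfolding abs_mult using lead_le_sqrt[OF p01] r by (intro mult_mono) auto
    also have "sqrt (real N) = real N powr (1 / 2)" by (simp add: powr_half_sqrt)
    also have "C / real N ^ (M + 1) = C * real N powr (- real (M + 1))"
      using N by (simp only: powr_minus powr_realpow divide_inverse of_nat_0_less_iff)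
    also have "real N powr (1 / 2) * (C * real N powr (- real (M + 1))) =
        C * real N powr (1 / 2 + - real (M + 1))"
      by (simp only: powr_add mult_ac)
    also have "1 / 2 + - real (M + 1) = - real M - 1 / 2" by simp
    finally show ?thesis .
  qed
  with C show ?thesis
    unfolding atLeast0AtMost by (intro exI[of _ C]) blast
qed

section \<open>The coefficients separated by parity\<close>

lemma a_coeff_odd:
  assumes "j \<ge> 1"
  shows "a_coeff (2 * j - 1) h p = 1 / (2 * real j * (2 * real j - 1)) *
    (bernoulli_number (2 * j)
      - (p powi (1 - 2 * int j) + (1 - p) powi (1 - 2 * int j)) * bernoulli_poly (2 * j) h)"
proof -
  have "2 * j - 1 + 1 = 2 * j" "- int (2 * j - 1) = 1 - 2 * int j"
    "real (2 * j - 1) = 2 * real j - 1"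
    using assms by (auto simp: of_nat_diff)
  then show ?thesis
    unfolding a_coeff_def by (simp add: mult_ac)
qed

text \<open>The Bernoulli number of odd index 2j + 1 >= 3 vanishes, and the prefactor -1 cancels the
  minus sign in front of the remaining product.\<close>

lemma a_coeff_even:
  assumes "j \<ge> 1"
  shows "a_coeff (2 * j) h p =
    (p powi (- 2 * int j) - (1 - p) powi (- 2 * int j)) / (2 * real j * (2 * real j + 1)) *
      bernoulli_poly (2 * j + 1) h"
proof -
  have "bernoulli_number (2 * j + 1) = 0"
    using bernoulli_fps_odd[OF assms] by (simp add: bernoulli_number_def bernoulli_poly_eq)
  moreover have "- int (2 * j) = - 2 * int j" "real (2 * j) = 2 * real j"
    "real (2 * j + 1) = 2 * real j + 1" by auto
  moreover have "(-1 :: real) ^ (2 * j + 1) = -1" by simp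
  ultimately show ?thesis
    unfolding a_coeff_def by (simp only:) simp
qed

theorem theorem4p2:
  shows
    "exp_asymp_expansion mean_abs_dev lead (\<lambda>k N p. a_coeff k (hN N p) p) \<and>
     (\<forall>(p::real) (h::real) (j::nat). 0 < p \<and> p < 1 \<and> 1 \<le> j \<longrightarrow>
        a_coeff (2 * j - 1) h p =
          1 / (2 * real j * (2 * real j - 1)) *
          (bernoulli_number (2 * j)
           - (p powi (1 - 2 * int j) + (1 - p) powi (1 - 2 * int j)) * bernoulli_poly (2 * j) h) \<and>
        a_coeff (2 * j) h p =
          (p powi (- 2 * int j) - (1 - p) powi (- 2 * int j)) / (2 * real j * (2 * real j + 1)) *
          bernoulli_poly (2 * j + 1) h) \<and>
     (\<forall>(p::real) (h::real) (M::nat) (m::nat). 0 < p \<and> p < 1 \<and> m \<le> M \<longrightarrow>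
        exp_coeff M (\<lambda>k. a_coeff k h p) m = d_coeff m h p) \<and>
     asymp_expansion mean_abs_dev lead (\<lambda>m N p. d_coeff m (hN N p) p) \<and>
     (\<forall>(M::nat) (K::real set). compact K \<and> K \<subseteq> {0<..<1} \<longrightarrow>
        (\<exists>C. \<forall>N\<ge>1. \<forall>p\<in>K. \<exists>r.
           mean_abs_dev N p =
             sqrt (2 * real N * p * (1 - p) / pi) *
             ((\<Sum>m = 0..M. d_coeff m (hN N p) p / real N ^ m) + r) \<and>
           \<bar>r\<bar> \<le> C / real N ^ (M + 1) \<and>
           \<bar>sqrt (2 * real N * p * (1 - p) / pi) * r\<bar> \<le> C * real N powr (- real M - 1 / 2)))"
proof -
  \<comment> \<open>Only coefficients with n <= M enter, and there \<open>exp_coeff_a_coeff\<close>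
    identifies the two families.\<close>
  have "exp_asymp_expansion mean_abs_dev lead (\<lambda>k N p. a_coeff k (hN N p) p)"
    using mean_abs_dev_expansion
    by (simp add: exp_asymp_expansion_def asymp_expansion_def exp_coeff_a_coeff)
  then show ?thesis
    using a_coeff_odd a_coeff_even exp_coeff_a_coeff mean_abs_dev_expansion
      mean_abs_dev_expansion_absolute[unfolded lead_def] by blast
qed

end
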